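(* The snare and every $n$-nova with $n \geq 2$ are HC-obstructions. Moreover, these are the only HC-obstructions which are split graphs; that is, a split graph is an HC-obstruction if and only if it is isomorphic to the snare or to an $n$-nova for some $n \geq 2$.
   Context: Graphs are finite, without loops or parallel edges. A Hamiltonian cycle of a graph $G$ is a (not necessarily induced) subgraph of $G$ which is a cycle containing every vertex of $G$; $G$ is Hamiltonian if it has one. A graph $H$ is an HC-obstruction if $H$ is $2$-connected, has no Hamiltonian cycle, and every induced subgraph of $H$ either equals $H$, or is not $2$-connected, or has a Hamiltonian cycle. A split graph is a graph whose vertex set can be partitioned into a stable set and a clique. The net is the graph with vertex set $\{a,b,c,a',b',c'\}$ and edge set $\{a'b', b'c', a'c', aa', bb', cc'\}$. The snare is the graph obtained from the net by adding a vertex adjacent to every vertex of the net. For $n \geq 2$, an $n$-sun is the graph obtained from a cycle $C$ with $2n$ vertices $v_1,\dots,v_{2n}$ in this order along $C$ by adding all edges $v_{2i}v_{2j}$ for distinct $i,j \in \{1,\dots,n\}$; an $n$-nova is obtained from an $n$-sun by adding a new vertex $w$ and the edges $wv_{2i}$ for all $i \in \{1,\dots,n\}$. *)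

theory Defs
  imports Main
begin

text \<open>A graph is a pair of a vertex set and a set of edges, each edge being an unordered pair
  of distinct vertices.\<close>

type_synonym 'a graph = "'a set \<times> 'a set set"

abbreviation verts :: "'a graph \<Rightarrow> 'a set" where
  "verts G \<equiv> fst G"

abbreviation edges :: "'a graph \<Rightarrow> 'a set set" where
  "edges G \<equiv> snd G"

definition simple_graph :: "'a graph \<Rightarrow> bool" where
  "simple_graph G \<longleftrightarrow> finite (verts G) \<and> (\<forall>e\<in>edges G. e \<subseteq> verts G \<and> card e = 2)"

definition adjacent :: "'a graph \<Rightarrow> 'a \<Rightarrow> 'a \<Rightarrow> bool" where
  "adjacent G u v \<longleftrightarrow> {u, v} \<in> edges G"

definition subgraph :: "'a graph \<Rightarrow> 'a graph \<Rightarrow> bool" where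
  "subgraph K G \<longleftrightarrow> simple_graph K \<and> verts K \<subseteq> verts G \<and> edges K \<subseteq> edges G"

definition induce :: "'a graph \<Rightarrow> 'a set \<Rightarrow> 'a graph" where
  "induce G X = (X, {e \<in> edges G. e \<subseteq> X})"

definition induced_subgraph :: "'a graph \<Rightarrow> 'a graph \<Rightarrow> bool" where
  "induced_subgraph K G \<longleftrightarrow> (\<exists>X. X \<subseteq> verts G \<and> K = induce G X)"

definition graph_iso :: "'a graph \<Rightarrow> 'b graph \<Rightarrow> bool" where
  "graph_iso G H \<longleftrightarrow>
     (\<exists>f. bij_betw f (verts G) (verts H) \<and>
          (\<forall>u\<in>verts G. \<forall>v\<in>verts G. adjacent G u v \<longleftrightarrow> adjacent H (f u) (f v)))"

definition connected_graph :: "'a graph \<Rightarrow> bool" where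
  "connected_graph G \<longleftrightarrow>
     verts G \<noteq> {} \<and> (\<forall>u\<in>verts G. \<forall>v\<in>verts G. (adjacent G)\<^sup>*\<^sup>* u v)"

text \<open>As usual, a 2-connected graph has at least three vertices; in particular the complete graph
  on two vertices is not 2-connected.\<close>

definition two_connected :: "'a graph \<Rightarrow> bool" where
  "two_connected G \<longleftrightarrow>
     card (verts G) \<ge> 3 \<and> connected_graph G \<and>
     (\<forall>v\<in>verts G. connected_graph (induce G (verts G - {v})))"

text \<open>\<open>cycle_graph vs\<close> is a cycle only if \<open>vs\<close> is distinct and has length at least 3.\<close>

definition cycle_graph :: "'a list \<Rightarrow> 'a graph" where
  "cycle_graph vs = (set vs, {{vs ! i, vs ! (Suc i mod length vs)} | i. i < length vs})"

definition is_cycle :: "'a graph \<Rightarrow> bool" where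
  "is_cycle C \<longleftrightarrow> (\<exists>vs. distinct vs \<and> length vs \<ge> 3 \<and> C = cycle_graph vs)"

definition hamiltonian_cycle :: "'a graph \<Rightarrow> 'a graph \<Rightarrow> bool" where
  "hamiltonian_cycle G C \<longleftrightarrow> subgraph C G \<and> is_cycle C \<and> verts C = verts G"

definition hamiltonian :: "'a graph \<Rightarrow> bool" where
  "hamiltonian G \<longleftrightarrow> (\<exists>C. hamiltonian_cycle G C)"

definition HC_obstruction :: "'a graph \<Rightarrow> bool" where
  "HC_obstruction H \<longleftrightarrow>
     simple_graph H \<and> two_connected H \<and> \<not> hamiltonian H \<and>
     (\<forall>K. induced_subgraph K H \<longrightarrow> K = H \<or> \<not> two_connected K \<or> hamiltonian K)"

definition stable_set :: "'a graph \<Rightarrow> 'a set \<Rightarrow> bool" where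
  "stable_set G S \<longleftrightarrow> S \<subseteq> verts G \<and> (\<forall>u\<in>S. \<forall>v\<in>S. \<not> adjacent G u v)"

definition clique :: "'a graph \<Rightarrow> 'a set \<Rightarrow> bool" where
  "clique G K \<longleftrightarrow> K \<subseteq> verts G \<and> (\<forall>u\<in>K. \<forall>v\<in>K. u \<noteq> v \<longrightarrow> adjacent G u v)"

definition split_graph :: "'a graph \<Rightarrow> bool" where
  "split_graph G \<longleftrightarrow>
     (\<exists>S K. S \<union> K = verts G \<and> S \<inter> K = {} \<and> stable_set G S \<and> clique G K)"

text \<open>\<open>add_vertex G X\<close> adds to \<open>G\<close> a new vertex, \<open>None\<close>, whose neighbours are the vertices
  in \<open>X\<close>; the old vertices are tagged with \<open>Some\<close>.\<close>

definition add_vertex :: "'a graph \<Rightarrow> 'a set \<Rightarrow> 'a option graph" where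
  "add_vertex G X =
     (insert None (Some ` verts G),
      (\<lambda>e. Some ` e) ` edges G \<union> {{None, Some x} | x. x \<in> X})"

datatype net_vertex = net_a | net_b | net_c | net_a' | net_b' | net_c'

definition net :: "net_vertex graph" where
  "net =
     ({net_a, net_b, net_c, net_a', net_b', net_c'},
      {{net_a', net_b'}, {net_b', net_c'}, {net_a', net_c'},
       {net_a, net_a'}, {net_b, net_b'}, {net_c, net_c'}})"

definition snare :: "net_vertex option graph" where
  "snare = add_vertex net (verts net)"

text \<open>The number \<open>k\<close> stands for the vertex $v_k$, for $1 \le k \le 2n$.\<close>

definition sun :: "nat \<Rightarrow> nat graph" where
  "sun n =
     (let C = cycle_graph [1..<2 * n + 1]
      in (verts C, edges C \<union> {{2 * i, 2 * j} | i j. i \<in> {1..n} \<and> j \<in> {1..n} \<and> i \<noteq> j}))"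

definition nova :: "nat \<Rightarrow> nat option graph" where
  "nova n = add_vertex (sun n) {2 * i | i. i \<in> {1..n}}"

end

theory Submission
  imports Defs
begin

text \<open>Let \<open>G\<close> be a split obstruction with stable set \<open>S\<close> (chosen maximal) and clique \<open>K\<close>, containing no
  induced snare or nova. Minimality gives a Hamiltonian cycle of \<open>G - s\<close> for every \<open>s \<in> S\<close>, and a
  neighbour of degree two in \<open>S\<close> for every \<open>y \<in> K\<close>. Excluding the snare and the 2-nova, among any
  three \<open>S\<close>-neighbours of \<open>y\<close> one is complete to \<open>K\<close>, and at most one vertex of \<open>S\<close> is complete to \<open>K\<close>.
  If there is one, the Hamiltonian cycle avoiding it is a chordless alternating cycle and yields a
  nova. Otherwise every \<open>y \<in> K\<close> has at most two neighbours in \<open>S\<close>, so each neighbour of \<open>s\<close> lies on an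
  edge inside \<open>K\<close> of the Hamiltonian cycle of \<open>G - s\<close>. Rotating that cycle makes \<open>G\<close> Hamiltonian if \<open>s\<close> has
  degree at least three; if all of \<open>S\<close> has degree two, either the two turns at the neighbours of \<open>s\<close>
  can again be rerouted through \<open>s\<close>, or the arc between them closes up to an alternating cycle, which
  together with a vertex of \<open>K\<close> outside it forms a nova.\<close>

section \<open>Graphs and cycles\<close>

text \<open>Forbidding induced copies loses nothing: a copy is itself 2-connected and not
  Hamiltonian, so minimality makes it span \<open>G\<close>, which is then isomorphic to the snare
  or a nova. The 2-nova is an edge joined to three independent vertices, so its absence says that no
  three pairwise nonadjacent vertices share two neighbours in \<open>K\<close>. The obstacle is that
  Hamiltonicity is global while these exclusions are local. The link is the cycle of
  \<open>G - s\<close>: two neighbours of \<open>s\<close> whose successors both lie in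
  \<open>K\<close> allow \<open>s\<close> to be absorbed, because the two successors are distinct
  and hence adjacent; the same holds for predecessors. A neighbour of \<open>s\<close> with no cycle
  neighbour in \<open>K\<close> would see three vertices of \<open>S\<close>, one of them complete.
  So every neighbour of \<open>s\<close> has a turn into \<open>K\<close> on one of two sides, and
  three neighbours force a repeated side. With two neighbours only opposite sides survive. By then
  every vertex of \<open>S\<close> has degree two, which is why the alternating cycle extracted
  there has no chord between \<open>S\<close> and \<open>K\<close>.\<close>

lemma adjacent_sym: "adjacent G u v \<longleftrightarrow> adjacent G v u"
  by (simp add: adjacent_def insert_commute)

lemma adjacent_verts:
  assumes "simple_graph G" "adjacent G u v"
  shows "u \<in> verts G" "v \<in> verts G" "u \<noteq> v"
proof -
  have "{u, v} \<subseteq> verts G \<and> card {u, v} = 2"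
    using assms unfolding simple_graph_def adjacent_def by blast
  then show "u \<in> verts G" "v \<in> verts G" "u \<noteq> v" by (auto simp: card_insert_if split: if_splits)
qed

lemma adjacent_induce: "adjacent (induce G X) u v \<longleftrightarrow> adjacent G u v \<and> u \<in> X \<and> v \<in> X"
  by (auto simp: adjacent_def induce_def)

lemma verts_induce [simp]: "verts (induce G X) = X"
  by (simp add: induce_def)

lemma simple_graph_induce: "simple_graph G \<Longrightarrow> X \<subseteq> verts G \<Longrightarrow> simple_graph (induce G X)"
  by (auto simp: simple_graph_def induce_def intro: finite_subset)

lemma induce_verts: "simple_graph G \<Longrightarrow> induce G (verts G) = G"
  by (cases G) (auto simp: simple_graph_def induce_def)

text \<open>Cycles are vertex lists so that cutting, reversing and splicing become list operations;
  the pair of last and first entry is the closing edge.\<close>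

definition cycle_list :: "'a graph \<Rightarrow> 'a list \<Rightarrow> bool" where
  "cycle_list G vs \<longleftrightarrow> distinct vs \<and> 3 \<le> length vs \<and> successively (adjacent G) vs \<and>
     adjacent G (last vs) (hd vs)"

text \<open>Bridge to \<open>cycle_graph\<close>, whose edges are given by indices modulo the
  length: the wrap-around at the last index is the closing edge.\<close>

lemma cycle_list_nth:
  assumes "vs \<noteq> []"
  shows "successively (adjacent G) vs \<and> adjacent G (last vs) (hd vs) \<longleftrightarrow>
    (\<forall>i<length vs. adjacent G (vs ! i) (vs ! (Suc i mod length vs)))" (is "?L \<longleftrightarrow> ?R")
proof
  assume L: ?L
  show ?R
  proof (intro allI impI)
    fix i assume i: "i < length vs"
    show "adjacent G (vs ! i) (vs ! (Suc i mod length vs))"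
    proof (cases "Suc i = length vs")
      case True
      then have "i = length vs - 1" by simp
      then show ?thesis using L True assms by (simp add: last_conv_nth hd_conv_nth)
    next
      case False
      then show ?thesis using L i by (simp add: successively_conv_nth)
    qed
  qed
next
  assume R: ?R
  have "adjacent G (vs ! i) (vs ! Suc i)" if "Suc i < length vs" for i
    using R[rule_format, of i] that by simp
  moreover have "adjacent G (last vs) (hd vs)"
    using R[rule_format, of "length vs - 1"] assms by (simp add: last_conv_nth hd_conv_nth)
  ultimately show ?L by (simp add: successively_conv_nth)
qed

lemma hamiltonian_iff_cycle_list:
  assumes "simple_graph G"
  shows "hamiltonian G \<longleftrightarrow> (\<exists>vs. cycle_list G vs \<and> set vs = verts G)"
proof
  assume "hamiltonian G"
  then obtain vs where vs: "subgraph (cycle_graph vs) G" "distinct vs" "length vs \<ge> 3" "set vs = verts G"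
    by (auto simp: hamiltonian_def hamiltonian_cycle_def is_cycle_def cycle_graph_def)
  have "\<forall>i<length vs. adjacent G (vs ! i) (vs ! (Suc i mod length vs))"
    using vs(1) by (auto simp: subgraph_def cycle_graph_def adjacent_def)
  moreover have "vs \<noteq> []" using vs(3) by auto
  ultimately have "cycle_list G vs"
    using vs cycle_list_nth[of vs G] by (simp add: cycle_list_def)
  then show "\<exists>vs. cycle_list G vs \<and> set vs = verts G" using vs(4) by blast
next
  assume "\<exists>vs. cycle_list G vs \<and> set vs = verts G"
  then obtain vs where vs: "cycle_list G vs" "set vs = verts G" by blast
  then have "\<forall>i<length vs. adjacent G (vs ! i) (vs ! (Suc i mod length vs))"
    using cycle_list_nth[of vs G] by (cases "vs = []") (simp_all add: cycle_list_def)
  then have sub: "edges (cycle_graph vs) \<subseteq> edges G"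
    by (auto simp: cycle_graph_def adjacent_def)
  moreover have ver: "verts (cycle_graph vs) = verts G"
    using vs by (simp add: cycle_graph_def)
  ultimately have "subgraph (cycle_graph vs) G"
    using assms by (auto simp: subgraph_def simple_graph_def)
  then show "hamiltonian G"
    using vs ver unfolding hamiltonian_def hamiltonian_cycle_def is_cycle_def cycle_list_def by blast
qed

lemma cycle_list_induce:
  assumes "set vs \<subseteq> X"
  shows "cycle_list (induce G X) vs \<longleftrightarrow> cycle_list G vs"
proof -
  have "successively (adjacent (induce G X)) vs \<longleftrightarrow> successively (adjacent G) vs"
    using assms by (intro successively_cong) (auto simp: adjacent_induce)
  moreover have "last vs \<in> X \<and> hd vs \<in> X" if "length vs \<ge> 3"
    using assms that by (metis hd_in_set last_in_set list.size(3) not_numeral_le_zero subsetD)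
  ultimately show ?thesis by (auto simp: cycle_list_def adjacent_induce)
qed

lemma hamiltonian_induce_iff:
  assumes "simple_graph G" "X \<subseteq> verts G"
  shows "hamiltonian (induce G X) \<longleftrightarrow> (\<exists>vs. cycle_list G vs \<and> set vs = X)"
  using hamiltonian_iff_cycle_list[OF simple_graph_induce[OF assms]] cycle_list_induce
  by (metis order_refl verts_induce)

lemma cycle_list_rotate: "cycle_list G (xs @ ys) \<Longrightarrow> cycle_list G (ys @ xs)"
  by (cases "xs = []"; cases "ys = []")
    (auto simp: cycle_list_def successively_append_iff)

lemma cycle_list_rev: "cycle_list G vs \<Longrightarrow> cycle_list G (rev vs)"
  by (auto simp: cycle_list_def last_rev hd_rev adjacent_sym)

section \<open>Successors on a cyclic list\<close>

text \<open>The successor is read off a split of the list, not off indices, so that invariance under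
  rotation needs only associativity of append. In \<open>hd (B @ A)\<close> the part
  \<open>A\<close> supplies the wrap-around when \<open>a\<close> is the last entry.\<close>

definition cyc_next :: "'a list \<Rightarrow> 'a \<Rightarrow> 'a \<Rightarrow> bool" where
  "cyc_next vs a b \<longleftrightarrow> (\<exists>A B. vs = A @ a # B \<and> A @ B \<noteq> [] \<and> b = hd (B @ A))"

lemma cyc_next_rotate:
  assumes "cyc_next (xs @ ys) a b"
  shows "cyc_next (ys @ xs) a b"
proof -
  from assms obtain A B where AB: "xs @ ys = A @ a # B" "A @ B \<noteq> []" "b = hd (B @ A)"
    unfolding cyc_next_def by blast
  from AB(1) consider C where "xs = A @ a # C" "B = C @ ys" | C where "ys = C @ a # B" "A = xs @ C"
    by (auto simp: append_eq_append_conv2 Cons_eq_append_conv append_eq_Cons_conv)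
  then show ?thesis
  proof cases
    case 1
    then have "ys @ xs = (ys @ A) @ a # C" "b = hd (C @ ys @ A)" "(ys @ A) @ C \<noteq> []"
      using AB by auto
    then show ?thesis unfolding cyc_next_def by blast
  next
    case 2
    then have "ys @ xs = C @ a # (B @ xs)" "b = hd ((B @ xs) @ C)" "C @ B @ xs \<noteq> []"
      using AB by auto
    then show ?thesis unfolding cyc_next_def by blast
  qed
qed

lemma cyc_next_rev:
  assumes "cyc_next (rev vs) b a"
  shows "cyc_next vs a b"
proof -
  from assms obtain A B where AB: "rev vs = A @ b # B" "A @ B \<noteq> []" "a = hd (B @ A)"
    unfolding cyc_next_def by blast
  then have "vs = rev (A @ b # B)" by (metis rev_rev_ident)
  then have vs: "vs = rev B @ b # rev A" by simp
  then have "cyc_next ((b # rev A) @ rev B) a b"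
  proof -
    \<comment> \<open>Once the reversed list is rotated to start with \<open>b\<close>, the vertex
      \<open>a = hd (B @ A)\<close> has become its last entry, so its successor wraps around to
      \<open>b\<close>.\<close>
    have "(b # rev A) @ rev B = b # rev (B @ A)" by simp
    also have "\<dots> = (b # rev (tl (B @ A))) @ a # []"
      using AB(2,3) by (cases "B @ A") auto
    finally show ?thesis unfolding cyc_next_def
      by (metis append.right_neutral append_Cons append_Nil list.sel(1) list.distinct(1))
  qed
  then show ?thesis using cyc_next_rotate[of "b # rev A" "rev B"] vs by simp
qed

lemma cyc_next_rev_iff: "cyc_next (rev vs) b a \<longleftrightarrow> cyc_next vs a b"
  using cyc_next_rev[of vs b a] cyc_next_rev[of "rev vs" a b] by auto

lemma cyc_next_ex:
  assumes "a \<in> set vs" "2 \<le> length vs"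
  shows "\<exists>b. cyc_next vs a b"
proof -
  obtain A B where "vs = A @ a # B" using assms by (meson split_list)
  moreover from this have "A @ B \<noteq> []" using assms by auto
  ultimately show ?thesis unfolding cyc_next_def by blast
qed

lemma cyc_prev_ex: "a \<in> set vs \<Longrightarrow> 2 \<le> length vs \<Longrightarrow> \<exists>b. cyc_next vs b a"
  using cyc_next_ex[of a "rev vs"] by (auto simp: cyc_next_rev_iff)

lemma cyc_next_unique:
  assumes "distinct vs" "cyc_next vs a b" "cyc_next vs a c"
  shows "b = c"
proof -
  from assms(2) obtain A B where "vs = A @ a # B" "b = hd (B @ A)" unfolding cyc_next_def by blast
  moreover from assms(3) obtain A' B' where "vs = A' @ a # B'" "c = hd (B' @ A')"
    unfolding cyc_next_def by blast
  ultimately show ?thesis using assms(1)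
    by (metis append_Cons_eq_iff distinct_append not_distinct_conv_prefix distinct.simps(2))
qed

lemma cyc_prev_unique: "distinct vs \<Longrightarrow> cyc_next vs b a \<Longrightarrow> cyc_next vs c a \<Longrightarrow> b = c"
  using cyc_next_unique[of "rev vs" a b c] by (simp add: cyc_next_rev_iff)

lemma cyc_next_set: "cyc_next vs a b \<Longrightarrow> a \<in> set vs \<and> b \<in> set vs"
  unfolding cyc_next_def by (auto simp: hd_append intro: hd_in_set)

text \<open>Normal form for later arguments: the cycle starts at a chosen vertex while the successor
  relation is unchanged, so the two cycle neighbours of \<open>a\<close> are the first and the last
  entry of \<open>us\<close>.\<close>

lemma cycle_list_split:
  assumes "cycle_list G vs" "a \<in> set vs"
  obtains us where "cycle_list G (a # us)" "set vs = insert a (set us)"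
    "\<And>x y. cyc_next (a # us) x y \<longleftrightarrow> cyc_next vs x y"
proof -
  obtain A B where vs: "vs = A @ a # B" using assms(2) by (meson split_list)
  show ?thesis
  proof (rule that[of "B @ A"])
    show "cycle_list G (a # B @ A)" using cycle_list_rotate[of G A "a # B"] assms(1) vs by simp
    show "cyc_next (a # B @ A) x y \<longleftrightarrow> cyc_next vs x y" for x y
      using cyc_next_rotate[of A "a # B" x y] cyc_next_rotate[of "a # B" A x y] vs by auto
  qed (use vs in auto)
qed

lemma cyc_next_Cons:
  assumes "distinct (a # us)" "us \<noteq> []"
  shows "cyc_next (a # us) a b \<longleftrightarrow> b = hd us" "cyc_next (a # us) b a \<longleftrightarrow> b = last us"
proof -
  have 1: "cyc_next (a # us) a (hd us)" if "us \<noteq> []" for us :: "'a list"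
    unfolding cyc_next_def using that by (metis append_Nil append.right_neutral)
  show "cyc_next (a # us) a b \<longleftrightarrow> b = hd us"
    using 1[OF assms(2)] cyc_next_unique[OF assms(1)] by blast
  have "cyc_next (a # rev us) a (hd (rev us))" using 1 assms(2) by simp
  then have "cyc_next (rev us @ [a]) a (hd (rev us))" using cyc_next_rotate[of "[a]" "rev us"] by simp
  then have "cyc_next (a # us) (last us) a" using cyc_next_rev[of "a # us"] by (simp add: hd_rev)
  then show "cyc_next (a # us) b a \<longleftrightarrow> b = last us"
    using cyc_prev_unique[OF assms(1)] by blast
qed

lemma cyc_next_adjacent:
  assumes "cycle_list G vs" "cyc_next vs a b"
  shows "adjacent G a b"
proof -
  obtain us where us: "cycle_list G (a # us)" "\<And>x y. cyc_next (a # us) x y \<longleftrightarrow> cyc_next vs x y"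
    using cycle_list_split[OF assms(1)] cyc_next_set[OF assms(2)] by metis
  then have "us \<noteq> []" "distinct (a # us)" by (auto simp: cycle_list_def)
  then have "b = hd us" using cyc_next_Cons[of a us b] us(2) assms(2) by blast
  then show ?thesis using us(1) \<open>us \<noteq> []\<close> by (cases us) (auto simp: cycle_list_def)
qed

text \<open>A cycle has length at least three, so \<open>us\<close> has at least two entries and its
  first and last entries differ.\<close>

lemma cyc_next_neq_prev:
  assumes "cycle_list G vs" "cyc_next vs a b" "cyc_next vs c a"
  shows "b \<noteq> c"
proof -
  obtain us where us: "cycle_list G (a # us)" "\<And>x y. cyc_next (a # us) x y \<longleftrightarrow> cyc_next vs x y"
    using cycle_list_split[OF assms(1)] cyc_next_set[OF assms(2)] by metis
  then have d: "us \<noteq> []" "distinct (a # us)" by (auto simp: cycle_list_def)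
  then have bc: "b = hd us" "c = last us" using cyc_next_Cons[of a us] us(2) assms by blast+
  from us(1) obtain x y zs where "us = x # y # zs"
    by (cases us; cases "tl us") (auto simp: cycle_list_def)
  then show ?thesis using bc d by auto
qed

lemma cyc_next_nth_iff:
  assumes "distinct vs" "2 \<le> length vs" "i < length vs" "j < length vs"
  shows "cyc_next vs (vs ! i) (vs ! j) \<longleftrightarrow> j = Suc i mod length vs"
proof -
  have vs: "vs = take i vs @ vs ! i # drop (Suc i) vs" using assms(3) by (rule id_take_nth_drop)
  have "hd (drop (Suc i) vs @ take i vs) = vs ! (Suc i mod length vs)"
  proof (cases "Suc i = length vs")
    case True
    then have "i \<noteq> 0" using assms(2) by auto
    moreover have "vs \<noteq> []" using assms(2) by auto
    ultimately show ?thesis using True by (simp add: hd_append hd_conv_nth)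
  next
    case False
    then show ?thesis using assms(3) by (simp add: hd_append hd_drop_conv_nth)
  qed
  moreover have "take i vs @ drop (Suc i) vs \<noteq> []" using assms(2,3) by auto
  ultimately have nx: "cyc_next vs (vs ! i) (vs ! (Suc i mod length vs))"
    unfolding cyc_next_def using vs by metis
  have "Suc i mod length vs < length vs" using assms by (intro mod_less_divisor) auto
  then show ?thesis using nx cyc_next_unique[OF assms(1)] assms(1,4) nth_eq_iff_index_eq by metis
qed

section \<open>Absorbing one more vertex into a cycle\<close>

text \<open>The segment \<open>A @ [y]\<close> after \<open>x\<close> is reversed and
  \<open>s\<close> is put between \<open>x\<close> and \<open>y\<close>. The only other new edge
  joins the old successor of \<open>x\<close>, which is \<open>hd (A @ [y])\<close> even for empty
  \<open>A\<close>, to the old successor of \<open>y\<close>. If \<open>B\<close> is empty, the old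
  edge at \<open>x\<close> closes the new cycle. Empty \<open>A\<close> gives plain insertion into
  the edge \<open>xy\<close>.\<close>

lemma cycle_list_extend:
  assumes c: "cycle_list G (x # A @ y # B)" and s: "s \<notin> set (x # A @ y # B)"
    and adj: "adjacent G s x" "adjacent G s y"
    and turn: "B \<noteq> [] \<Longrightarrow> adjacent G (hd (A @ [y])) (hd B)"
  shows "cycle_list G (x # s # y # rev A @ B)"
proof -
  have 1: "successively (adjacent G) (A @ [y])"
    using c by (auto simp: cycle_list_def successively_append_iff successively_Cons)
  have "successively (adjacent G) (rev (A @ [y]))"
    unfolding successively_rev using 1 by (rule successively_mono) (simp add: adjacent_sym)
  then have 2: "successively (adjacent G) (y # rev A)" by simp
  have 3: "successively (adjacent G) B"
    using c by (auto simp: cycle_list_def successively_append_iff successively_Cons)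
  have l: "last (y # rev A) = hd (A @ [y])" by (cases A) auto
  then have 4: "successively (adjacent G) (y # rev A @ B)"
    using 2 3 turn successively_append_iff[of "adjacent G" "y # rev A" B] by auto
  have 5: "adjacent G (last (y # rev A @ B)) x"
  proof (cases "B = []")
    case True
    have "adjacent G x (hd (A @ [y]))"
      using c by (cases A) (auto simp: cycle_list_def)
    then show ?thesis using True l by (simp add: adjacent_sym[of G x])
  next
    case False
    then show ?thesis using c by (simp add: cycle_list_def)
  qed
  show ?thesis
    using c s 4 5 adj by (auto simp: cycle_list_def adjacent_sym[of G x])
qed

lemma cycle_list_insert:
  assumes "cycle_list G vs" "cyc_next vs x y" "s \<notin> set vs" "adjacent G s x" "adjacent G s y"
  shows "\<exists>vs'. cycle_list G vs' \<and> set vs' = insert s (set vs)"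
proof -
  obtain us where us: "cycle_list G (x # us)" "set vs = insert x (set us)"
     "\<And>a b. cyc_next (x # us) a b \<longleftrightarrow> cyc_next vs a b"
    using cycle_list_split[OF assms(1)] cyc_next_set[OF assms(2)] by metis
  then have d: "us \<noteq> []" "distinct (x # us)" by (auto simp: cycle_list_def)
  then have "y = hd us" using cyc_next_Cons[of x us] us(3) assms by blast
  then obtain B where B: "us = y # B" using d by (cases us) auto
  have "cycle_list G (x # s # y # rev [] @ B)"
  proof (rule cycle_list_extend)
    show "adjacent G (hd ([] @ [y])) (hd B)" if "B \<noteq> []"
      using us(1) B that by (auto simp: cycle_list_def successively_Cons)
  qed (use us B assms in auto)
  then show ?thesis using us B by (intro exI[of _ "x # s # y # rev [] @ B"]) auto
qed

text \<open>Rotation in the style of Posa: the successors of \<open>x\<close> and \<open>y\<close>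
  are distinct members of a clique, which supplies exactly the edge required after reversing the
  segment.\<close>

lemma cycle_list_rotation:
  assumes c: "cycle_list G vs" and nx: "cyc_next vs x x'" "cyc_next vs y y'" and "x \<noteq> y"
    and K: "clique G K" "x' \<in> K" "y' \<in> K" and s: "s \<notin> set vs" "adjacent G s x" "adjacent G s y"
  shows "\<exists>vs'. cycle_list G vs' \<and> set vs' = insert s (set vs)"
proof -
  obtain us where us: "cycle_list G (x # us)" "set vs = insert x (set us)"
     "\<And>a b. cyc_next (x # us) a b \<longleftrightarrow> cyc_next vs a b"
    using cycle_list_split[OF c] cyc_next_set[OF nx(1)] by metis
  have d: "us \<noteq> []" "distinct (x # us)" using us(1) by (auto simp: cycle_list_def)
  then have x': "x' = hd us" using cyc_next_Cons[of x us] us(3) nx by blast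
  have "y \<in> set us" using us(2) cyc_next_set[OF nx(2)] \<open>x \<noteq> y\<close> by auto
  then obtain A B where AB: "us = A @ y # B" by (meson split_list)
  have "cyc_next (x # us) y (hd (B @ x # A))"
    unfolding cyc_next_def AB by (intro exI[of _ "x # A"] exI[of _ B]) auto
  then have y': "y' = hd (B @ x # A)" using us(3) nx(2) cyc_next_unique[OF d(2)] by metis
  have "cycle_list G (x # s # y # rev A @ B)"
  proof (rule cycle_list_extend)
    assume "B \<noteq> []"
    then have "y' = hd B" using y' by simp
    moreover have "x' = hd (A @ [y])" using x' AB by (cases A) auto
    moreover have "x' \<noteq> y'" using calculation d(2) AB \<open>B \<noteq> []\<close> by (cases A; cases B) auto
    ultimately show "adjacent G (hd (A @ [y])) (hd B)" using K unfolding clique_def by auto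
  qed (use us AB s in auto)
  then show ?thesis using us AB by (intro exI[of _ "x # s # y # rev A @ B"]) auto
qed

section \<open>Two-connectedness of split graphs\<close>

text \<open>Deleting \<open>u\<close> leaves \<open>v\<close> connected to some third vertex, so the
  first edge of a connecting walk avoids \<open>u\<close>. Leaving \<open>u\<close> arbitrary lets
  the lemma be applied twice, the second time with the first neighbour found.\<close>

lemma two_connected_neighbour:
  assumes "simple_graph G" "two_connected G" "v \<in> verts G" "u \<noteq> v"
  shows "\<exists>t. t \<noteq> u \<and> adjacent G v t"
proof -
  have card: "card (verts G) \<ge> 3" and conn: "connected_graph G"
    and conn': "\<And>x. x \<in> verts G \<Longrightarrow> connected_graph (induce G (verts G - {x}))"
    using assms(2) by (auto simp: two_connected_def)
  have fin: "finite (verts G)" using card by (metis card.infinite not_numeral_le_zero)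
  have "\<not> verts G \<subseteq> {u, v}"
  proof
    assume "verts G \<subseteq> {u, v}"
    then have "card (verts G) \<le> card {u, v}" by (intro card_mono) auto
    also have "\<dots> \<le> 2" by (simp add: card_insert_if)
    finally show False using card by simp
  qed
  then obtain x where x: "x \<in> verts G" "x \<noteq> u" "x \<noteq> v" by blast
  show ?thesis
  proof (cases "u \<in> verts G")
    case True
    have "(adjacent (induce G (verts G - {u})))\<^sup>*\<^sup>* v x"
      using conn'[OF True] x assms by (auto simp: connected_graph_def)
    then show ?thesis using x(3)
      by (cases rule: converse_rtranclpE) (auto simp: adjacent_induce)
  next
    case False
    have "(adjacent G)\<^sup>*\<^sup>* v x" using conn x assms by (auto simp: connected_graph_def)
    then obtain t where "adjacent G v t"
      using x(3) by (cases rule: converse_rtranclpE) auto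
    then show ?thesis using False adjacent_verts[OF assms(1)] by metis
  qed
qed

lemma connected_graph_clique_dominated:
  assumes K: "K \<subseteq> verts G" "\<And>u v. u \<in> K \<Longrightarrow> v \<in> K \<Longrightarrow> u \<noteq> v \<Longrightarrow> adjacent G u v" "c \<in> K"
    and dom: "\<And>v. v \<in> verts G - K \<Longrightarrow> \<exists>y\<in>K. adjacent G v y"
  shows "connected_graph G"
proof -
  have sym: "(adjacent G)\<^sup>*\<^sup>* u v" if "(adjacent G)\<^sup>*\<^sup>* v u" for u v
    using that by (metis (full_types) adjacent_sym symp_def symp_rtranclp)
  have toK: "(adjacent G)\<^sup>*\<^sup>* v c" if "v \<in> K" for v
    using K(2,3) that by (cases "v = c") auto
  have "(adjacent G)\<^sup>*\<^sup>* v c" if v: "v \<in> verts G" for v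
  proof (cases "v \<in> K")
    case False
    then obtain y where "y \<in> K" "adjacent G v y" using dom v by blast
    then show ?thesis using toK by (meson converse_rtranclp_into_rtranclp)
  qed (use toK in blast)
  then have "(adjacent G)\<^sup>*\<^sup>* u v" if "u \<in> verts G" "v \<in> verts G" for u v
    using sym that by (meson rtranclp_trans)
  then show ?thesis using K(1,3) by (auto simp: connected_graph_def)
qed

text \<open>After deleting any vertex the clique still has a member and every outside vertex keeps
  one of its two neighbours in it, so the rest is a clique with a dominated remainder and hence
  connected.\<close>

lemma two_connected_split:
  assumes K: "clique G K" "y \<in> K" "y' \<in> K" "y \<noteq> y'" and c: "3 \<le> card (verts G)"
    and dom: "\<And>s. s \<in> verts G - K \<Longrightarrow> \<exists>a\<in>K. \<exists>b\<in>K. a \<noteq> b \<and> adjacent G s a \<and> adjacent G s b"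
  shows "two_connected G"
  unfolding two_connected_def
proof (intro conjI ballI)
  show "connected_graph G"
  proof (rule connected_graph_clique_dominated[of K G y])
    show "\<exists>y\<in>K. adjacent G v y" if "v \<in> verts G - K" for v using dom[OF that] by blast
  qed (use K in \<open>auto simp: clique_def\<close>)
  fix v assume v: "v \<in> verts G"
  obtain c where c: "c \<in> K - {v}" using K by (cases "v = y") auto
  show "connected_graph (induce G (verts G - {v}))"
  proof (rule connected_graph_clique_dominated[of "K - {v}" _ c])
    fix u assume "u \<in> verts (induce G (verts G - {v})) - (K - {v})"
    then have u: "u \<in> verts G - K" "u \<noteq> v" by auto
    then obtain a b where "a \<in> K" "b \<in> K" "a \<noteq> b" "adjacent G u a" "adjacent G u b"
      using dom by blast
    then show "\<exists>y\<in>K - {v}. adjacent (induce G (verts G - {v})) u y"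
      using K(1) u by (cases "a = v") (auto simp: adjacent_induce clique_def)
  qed (use K c in \<open>auto simp: clique_def adjacent_induce\<close>)
qed (fact c)

lemma two_connected_two_neighbours:
  assumes "simple_graph G" "two_connected G" "v \<in> verts G"
  obtains a b where "a \<noteq> b" "adjacent G v a" "adjacent G v b"
proof -
  \<comment> \<open>The first application needs some dummy vertex other than \<open>v\<close>; it
    exists because the type contains the at least three vertices of \<open>G\<close>.\<close>
  have "\<exists>u. u \<noteq> v"
  proof (rule ccontr)
    assume "\<nexists>u. u \<noteq> v"
    then have "verts G \<subseteq> {v}" by blast
    then have "card (verts G) \<le> 1" using card_mono[of "{v}" "verts G"] by simp
    then show False using assms(2) by (simp add: two_connected_def)
  qed
  then obtain a where a: "adjacent G v a" using two_connected_neighbour[OF assms] by blast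
  then have "a \<noteq> v" using adjacent_verts(3)[OF assms(1)] by blast
  then obtain b where "b \<noteq> a" "adjacent G v b" using two_connected_neighbour[OF assms] by blast
  then show thesis using that a by blast
qed

text \<open>Taking successors along the cycle maps a stable set injectively into its complement.
  This counting bound is what keeps novas from being Hamiltonian.\<close>

lemma cycle_list_stable:
  assumes c: "cycle_list G vs" and st: "\<And>u v. u \<in> A \<Longrightarrow> v \<in> A \<Longrightarrow> \<not> adjacent G u v" and A: "A \<subseteq> set vs"
  shows "card A \<le> card (set vs - A)"
proof -
  have len: "2 \<le> length vs" and d: "distinct vs" using c by (auto simp: cycle_list_def)
  define f where "f a = (SOME b. cyc_next vs a b)" for a
  have f: "cyc_next vs a (f a)" if "a \<in> set vs" for a
    unfolding f_def using cyc_next_ex[OF that len] by (rule someI_ex)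
  have "f a \<in> set vs - A" if "a \<in> A" for a
    using f[of a] that A cyc_next_adjacent[OF c] cyc_next_set st by (metis DiffI subsetD)
  then have "f ` A \<subseteq> set vs - A" by blast
  moreover have "inj_on f A"
    using f A cyc_prev_unique[OF d] by (metis inj_onI subsetD)
  ultimately show ?thesis by (simp add: card_inj_on_le)
qed

lemma graph_iso_labels:
  assumes a: "bij_betw a I (verts G)" and b: "bij_betw b I (verts H)"
    and ab: "\<And>i j. i \<in> I \<Longrightarrow> j \<in> I \<Longrightarrow> adjacent G (a i) (a j) \<longleftrightarrow> adjacent H (b i) (b j)"
  shows "graph_iso G H"
proof -
  let ?f = "b \<circ> inv_into I a"
  have "bij_betw ?f (verts G) (verts H)"
    using bij_betw_trans[OF bij_betw_inv_into[OF a] b] .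
  moreover have "adjacent G u v \<longleftrightarrow> adjacent H (?f u) (?f v)" if "u \<in> verts G" "v \<in> verts G" for u v
    using ab[of "inv_into I a u" "inv_into I a v"] that a
    by (auto simp: bij_betw_def inv_into_into f_inv_into_f)
  ultimately show ?thesis unfolding graph_iso_def by blast
qed

lemma graph_iso_inverse:
  assumes "graph_iso G H"
  obtains g where "bij_betw g (verts H) (verts G)"
    "\<And>u v. u \<in> verts H \<Longrightarrow> v \<in> verts H \<Longrightarrow> adjacent G (g u) (g v) \<longleftrightarrow> adjacent H u v"
proof -
  obtain f where f: "bij_betw f (verts G) (verts H)"
    "\<forall>u\<in>verts G. \<forall>v\<in>verts G. adjacent G u v \<longleftrightarrow> adjacent H (f u) (f v)"
    using assms unfolding graph_iso_def by blast
  show thesis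
  proof (rule that)
    show "bij_betw (inv_into (verts G) f) (verts H) (verts G)" using f(1) by (rule bij_betw_inv_into)
    show "adjacent G (inv_into (verts G) f u) (inv_into (verts G) f v) \<longleftrightarrow> adjacent H u v"
      if "u \<in> verts H" "v \<in> verts H" for u v
      using f that by (auto simp: bij_betw_def inv_into_into f_inv_into_f)
  qed
qed

section \<open>Copies of small split graphs\<close>

text \<open>A common shape of the novas and the snare: \<open>k\<close> lists the clique of the sun or net,
  \<open>d\<close> the vertices outside it, and \<open>w\<close> is the added vertex.\<close>

definition split_copy ::
  "'a graph \<Rightarrow> nat \<Rightarrow> (nat \<Rightarrow> nat \<Rightarrow> bool) \<Rightarrow> bool \<Rightarrow> (nat \<Rightarrow> 'a) \<Rightarrow> (nat \<Rightarrow> 'a) \<Rightarrow> 'a \<Rightarrow> bool" where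
  "split_copy G n R c k d w \<longleftrightarrow> inj_on k {..<n} \<and> inj_on d {..<n} \<and>
     (\<forall>i<n. \<forall>j<n. k i \<noteq> d j) \<and> (\<forall>i<n. k i \<noteq> w \<and> d i \<noteq> w) \<and>
     (\<forall>i<n. \<forall>j<n. adjacent G (k i) (k j) \<longleftrightarrow> i \<noteq> j) \<and>
     (\<forall>i<n. \<forall>j<n. \<not> adjacent G (d i) (d j)) \<and>
     (\<forall>i<n. \<forall>j<n. adjacent G (d i) (k j) \<longleftrightarrow> R i j) \<and>
     (\<forall>i<n. adjacent G w (k i) \<and> (adjacent G w (d i) \<longleftrightarrow> c)) \<and> \<not> adjacent G w w"

definition copy_verts :: "nat \<Rightarrow> (nat \<Rightarrow> 'a) \<Rightarrow> (nat \<Rightarrow> 'a) \<Rightarrow> 'a \<Rightarrow> 'a set" where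
  "copy_verts n k d w = insert w (k ` {..<n} \<union> d ` {..<n})"

definition copy_label :: "(nat \<Rightarrow> 'a) \<Rightarrow> (nat \<Rightarrow> 'a) \<Rightarrow> 'a \<Rightarrow> (nat + nat) option \<Rightarrow> 'a" where
  "copy_label k d w x = (case x of None \<Rightarrow> w | Some (Inl i) \<Rightarrow> k i | Some (Inr i) \<Rightarrow> d i)"

lemma split_copy_label:
  assumes "split_copy G n R c k d w"
  shows "bij_betw (copy_label k d w) (insert None (Some ` ({..<n} <+> {..<n}))) (copy_verts n k d w)"
proof -
  have dist: "k i \<noteq> d j" if "i < n" "j < n" for i j
    using assms that by (auto simp: split_copy_def)
  have distw: "k i \<noteq> w" "d i \<noteq> w" if "i < n" for i
    using assms that by (auto simp: split_copy_def)
  have inj: "k i = k j \<longleftrightarrow> i = j" "d i = d j \<longleftrightarrow> i = j" if "i < n" "j < n" for i j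
    using assms that by (auto simp: split_copy_def inj_on_eq_iff)
  show ?thesis unfolding bij_betw_def
  proof
    show "inj_on (copy_label k d w) (insert None (Some ` ({..<n} <+> {..<n})))"
      by (auto simp: inj_on_def copy_label_def inj dest: dist dist[symmetric] distw distw[symmetric])
    show "copy_label k d w ` insert None (Some ` ({..<n} <+> {..<n})) = copy_verts n k d w"
      by (force simp: copy_label_def copy_verts_def image_iff split: sum.splits)
  qed
qed

lemma split_copy_adjacent:
  assumes "split_copy G n R c k d w" "i < n"
  shows "j < n \<Longrightarrow> adjacent G (k i) (k j) \<longleftrightarrow> i \<noteq> j"
    and "j < n \<Longrightarrow> \<not> adjacent G (d i) (d j)"
    and "j < n \<Longrightarrow> adjacent G (d i) (k j) \<longleftrightarrow> R i j"
    and "j < n \<Longrightarrow> adjacent G (k j) (d i) \<longleftrightarrow> R i j"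
    and "adjacent G w (k i)" "adjacent G (k i) w" "adjacent G w (d i) \<longleftrightarrow> c" "adjacent G (d i) w \<longleftrightarrow> c"
  using assms adjacent_sym[of G "k j" "d i"] adjacent_sym[of G w "k i"] adjacent_sym[of G w "d i"]
  by (auto simp: split_copy_def)

text \<open>The parameters \<open>n\<close>, \<open>R\<close> and \<open>c\<close> fix every
  adjacency between labels, so matching labels of two spanning copies is an isomorphism.\<close>

lemma split_copy_iso:
  assumes G: "split_copy G n R c k d w" "verts G = copy_verts n k d w"
    and H: "split_copy H n R c k' d' w'" "verts H = copy_verts n k' d' w'"
  shows "graph_iso G H"
proof (rule graph_iso_labels)
  show "bij_betw (copy_label k d w) (insert None (Some ` ({..<n} <+> {..<n}))) (verts G)"
    using split_copy_label[OF G(1)] G(2) by simp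
  show "bij_betw (copy_label k' d' w') (insert None (Some ` ({..<n} <+> {..<n}))) (verts H)"
    using split_copy_label[OF H(1)] H(2) by simp
  have ww: "\<not> adjacent G w w" "\<not> adjacent H w' w'"
    using G(1) H(1) by (simp_all add: split_copy_def)
  fix i j assume "i \<in> insert None (Some ` ({..<n} <+> {..<n}))" "j \<in> insert None (Some ` ({..<n} <+> {..<n}))"
  then show "adjacent G (copy_label k d w i) (copy_label k d w j) \<longleftrightarrow>
    adjacent H (copy_label k' d' w' i) (copy_label k' d' w' j)"
    by (elim insertE imageE PlusE)
      (simp_all add: copy_label_def split_copy_adjacent[OF G(1)] split_copy_adjacent[OF H(1)] ww)
qed

lemma split_copy_induce:
  assumes "split_copy G n R c k d w" "copy_verts n k d w \<subseteq> X"
  shows "split_copy (induce G X) n R c k d w"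
proof -
  have "k i \<in> X" "d i \<in> X" "w \<in> X" if "i < n" for i
    using assms(2) that by (auto simp: copy_verts_def)
  then show ?thesis using assms(1) by (simp add: split_copy_def adjacent_induce)
qed

lemma split_copy_subset:
  assumes "simple_graph G" "split_copy G n R c k d w" "0 < n" "\<And>i. i < n \<Longrightarrow> R i i"
  shows "copy_verts n k d w \<subseteq> verts G"
proof -
  have "adjacent G (d i) (k i)" "adjacent G w (k i)" if "i < n" for i
    using assms(2,4) that by (simp_all add: split_copy_def)
  then have "d i \<in> verts G" "k i \<in> verts G" "w \<in> verts G" if "i < n" for i
    using adjacent_verts[OF assms(1)] that by blast+
  then show ?thesis using assms(3) by (auto simp: copy_verts_def)
qed

lemma split_copy_transfer:
  assumes "graph_iso G H" "split_copy H n R c k d w" "verts H = copy_verts n k d w"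
  shows "\<exists>k d w. split_copy G n R c k d w \<and> verts G = copy_verts n k d w"
proof -
  obtain g where g: "bij_betw g (verts H) (verts G)"
    "\<And>u v. u \<in> verts H \<Longrightarrow> v \<in> verts H \<Longrightarrow> adjacent G (g u) (g v) \<longleftrightarrow> adjacent H u v"
    using graph_iso_inverse[OF assms(1)] by metis
  have in_verts: "k i \<in> verts H" "d i \<in> verts H" "w \<in> verts H" if "i < n" for i
    using assms(3) that by (auto simp: copy_verts_def)
  have inj: "g u = g v \<longleftrightarrow> u = v" if "u \<in> verts H" "v \<in> verts H" for u v
    using g(1) that by (auto simp: bij_betw_def inj_on_eq_iff)
  have w: "w \<in> verts H" using assms(3) by (simp add: copy_verts_def)
  have "split_copy G n R c (g \<circ> k) (g \<circ> d) (g w)"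
    using assms(2) in_verts w by (auto simp: split_copy_def inj g(2) inj_on_def)
  moreover have "verts G = copy_verts n (g \<circ> k) (g \<circ> d) (g w)"
    using g(1) assms(3) by (simp add: copy_verts_def bij_betw_def image_Un image_comp)
  ultimately show ?thesis by blast
qed

section \<open>Novas\<close>

text \<open>The rim of the sun is read as \<open>k 0\<close>, \<open>d 0\<close>,
  \<open>k 1\<close>, \<open>d 1\<close>, ... with indices modulo \<open>n\<close>, so
  \<open>d i\<close> sits between \<open>k i\<close> and its cyclic successor. The flag
  \<open>False\<close> says that the added vertex misses all of \<open>d\<close>.\<close>

definition nova_copy :: "'a graph \<Rightarrow> nat \<Rightarrow> (nat \<Rightarrow> 'a) \<Rightarrow> (nat \<Rightarrow> 'a) \<Rightarrow> 'a \<Rightarrow> bool" where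
  "nova_copy G n k d w \<longleftrightarrow> 2 \<le> n \<and> split_copy G n (\<lambda>i j. j = i \<or> j = Suc i mod n) False k d w"

lemmas nova_copy_iff = nova_copy_def[unfolded split_copy_def]

lemma nova_copy_induce:
  "nova_copy G n k d w \<Longrightarrow> copy_verts n k d w \<subseteq> X \<Longrightarrow> nova_copy (induce G X) n k d w"
  by (simp add: nova_copy_def split_copy_induce)

lemma nova_copy_adjacent:
  assumes "nova_copy G n k d w" "i < n"
  shows "j < n \<Longrightarrow> adjacent G (k i) (k j) \<longleftrightarrow> i \<noteq> j"
    and "j < n \<Longrightarrow> \<not> adjacent G (d i) (d j)"
    and "j < n \<Longrightarrow> adjacent G (d i) (k j) \<longleftrightarrow> j = i \<or> j = Suc i mod n"
    and "j < n \<Longrightarrow> adjacent G (k j) (d i) \<longleftrightarrow> j = i \<or> j = Suc i mod n"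
    and "adjacent G w (k i)" "adjacent G (k i) w" "\<not> adjacent G w (d i)" "\<not> adjacent G (d i) w"
proof -
  have "split_copy G n (\<lambda>i j. j = i \<or> j = Suc i mod n) False k d w"
    using assms(1) by (simp add: nova_copy_def)
  note adj = split_copy_adjacent[OF this assms(2)]
  show "j < n \<Longrightarrow> adjacent G (k i) (k j) \<longleftrightarrow> i \<noteq> j" "j < n \<Longrightarrow> \<not> adjacent G (d i) (d j)"
    "j < n \<Longrightarrow> adjacent G (d i) (k j) \<longleftrightarrow> j = i \<or> j = Suc i mod n"
    "j < n \<Longrightarrow> adjacent G (k j) (d i) \<longleftrightarrow> j = i \<or> j = Suc i mod n"
    "adjacent G w (k i)" "adjacent G (k i) w" "\<not> adjacent G w (d i)" "\<not> adjacent G (d i) w"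
    using adj by simp_all
qed

lemma nova_copy_two_connected:
  assumes G: "simple_graph G" "nova_copy G n k d w" "verts G = copy_verts n k d w"
  shows "two_connected G"
proof (rule two_connected_split)
  have n: "2 \<le> n" using G(2) by (simp add: nova_copy_iff)
  have neq: "Suc i mod n \<noteq> i" if "i < n" for i
    using n that by (cases "Suc i = n") auto
  have inj: "k i = k j \<longleftrightarrow> i = j" if "i < n" "j < n" for i j
    using G(2) that by (auto simp: nova_copy_iff inj_on_eq_iff)
  show "clique G (k ` {..<n})"
    using G(2,3) by (auto simp: clique_def nova_copy_iff copy_verts_def)
  show "k 0 \<in> k ` {..<n}" "k 1 \<in> k ` {..<n}" using n by auto
  show "k 0 \<noteq> k 1" using inj[of 0 1] n by simp
  have "{w, k 0, k 1} \<subseteq> verts G" using G(3) n by (auto simp: copy_verts_def)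
  moreover have "card {w, k 0, k 1} = 3"
  proof -
    have "w \<noteq> k 0" "w \<noteq> k 1" using n G(2) by (auto simp: nova_copy_iff)
    then show ?thesis using inj[of 0 1] n by simp
  qed
  ultimately show "3 \<le> card (verts G)" using G(1) by (metis card_mono simple_graph_def)
  fix s assume "s \<in> verts G - k ` {..<n}"
  then consider "s = w" | i where "i < n" "s = d i" using G(3) by (auto simp: copy_verts_def)
  then show "\<exists>a\<in>k ` {..<n}. \<exists>b\<in>k ` {..<n}. a \<noteq> b \<and> adjacent G s a \<and> adjacent G s b"
  proof cases
    case 1
    have "adjacent G w (k 0)" "adjacent G w (k 1)" using G(2) by (auto simp: nova_copy_iff)
    then show ?thesis using 1 \<open>k 0 \<in> _\<close> \<open>k 1 \<in> _\<close> \<open>k 0 \<noteq> k 1\<close> by blast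
  next
    case 2
    have m: "Suc i mod n < n" using n by simp
    then have "adjacent G s (k i)" "adjacent G s (k (Suc i mod n))"
      using G(2) 2 by (auto simp: nova_copy_iff)
    then show ?thesis using 2 m inj[of i "Suc i mod n"] neq[of i] by (metis imageI lessThan_iff)
  qed
qed

text \<open>The vertices \<open>d i\<close> together with \<open>w\<close> form a stable set of size
  \<open>n + 1\<close>, while only the \<open>n\<close> clique vertices remain to separate them on a
  cycle.\<close>

lemma nova_copy_not_hamiltonian:
  assumes G: "simple_graph G" "nova_copy G n k d w" "verts G = copy_verts n k d w"
  shows "\<not> hamiltonian G"
proof
  assume "hamiltonian G"
  then obtain vs where vs: "cycle_list G vs" "set vs = verts G"
    using hamiltonian_iff_cycle_list[OF G(1)] by blast
  have ww: "\<not> adjacent G w w" using G(2) by (simp add: nova_copy_iff)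
  let ?A = "insert w (d ` {..<n})"
  have "card ?A \<le> card (set vs - ?A)"
  proof (rule cycle_list_stable[OF vs(1)])
    show "\<not> adjacent G u v" if "u \<in> ?A" "v \<in> ?A" for u v
      using that ww by (auto simp: nova_copy_adjacent[OF G(2)])
  qed (use vs(2) G(3) in \<open>auto simp: copy_verts_def\<close>)
  moreover have "card ?A = Suc n"
  proof -
    have "w \<notin> d ` {..<n}" using G(2) by (auto simp: nova_copy_iff)
    moreover have "card (d ` {..<n}) = n" using G(2) by (simp add: nova_copy_iff card_image)
    ultimately show ?thesis by simp
  qed
  moreover have "card (set vs - ?A) \<le> card (k ` {..<n})"
    by (rule card_mono) (use vs(2) G(3) in \<open>auto simp: copy_verts_def\<close>)
  moreover have "card (k ` {..<n}) \<le> n" using card_image_le[of "{..<n}" k] by simp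
  ultimately show False by simp
qed

lemma Suc_add_mod_eq_iff:
  fixes i j a n :: nat
  assumes "i < n" "j < n"
  shows "(j + a) mod n = Suc ((i + a) mod n) mod n \<longleftrightarrow> j = Suc i mod n"
    and "(j + a) mod n = (i + a) mod n \<longleftrightarrow> j = i"
proof -
  have *: "(x + a) mod n = (y + a) mod n \<longleftrightarrow> x mod n = y mod n" for x y
  proof
    assume "(x + a) mod n = (y + a) mod n"
    \<comment> \<open>Adding \<open>(n - 1) * a\<close> completes the shift \<open>a\<close> to the
      multiple \<open>n * a\<close>, which vanishes modulo \<open>n\<close>; this cancels
      \<open>a\<close> without subtraction on naturals.\<close>
    then have "(x + a + (n - 1) * a) mod n = (y + a + (n - 1) * a) mod n" by (rule mod_add_cong) simp
    moreover have "z + a + (n - 1) * a = z + n * a" for z using assms(1) by (cases n) auto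
    ultimately show "x mod n = y mod n" by (metis mod_mult_self2)
  qed (rule mod_add_cong, auto)
  have "Suc ((i + a) mod n) mod n = (Suc i + a) mod n" by (simp add: mod_Suc_eq)
  then show "(j + a) mod n = Suc ((i + a) mod n) mod n \<longleftrightarrow> j = Suc i mod n"
    using *[of j "Suc i"] assms by simp
  show "(j + a) mod n = (i + a) mod n \<longleftrightarrow> j = i" using *[of j i] assms by simp
qed

text \<open>The rotational symmetry of a nova. It allows a missing \<open>d j\<close> to be moved to
  the last index.\<close>

lemma nova_copy_shift:
  assumes "nova_copy G n k d w"
  shows "nova_copy G n (\<lambda>i. k ((i + a) mod n)) (\<lambda>i. d ((i + a) mod n)) w"
    and "copy_verts n (\<lambda>i. k ((i + a) mod n)) (\<lambda>i. d ((i + a) mod n)) w = copy_verts n k d w"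
proof -
  have n: "2 \<le> n" using assms by (simp add: nova_copy_iff)
  then have lt: "x mod n < n" for x by simp
  have inj: "k i = k j \<longleftrightarrow> i = j" "d i = d j \<longleftrightarrow> i = j" if "i < n" "j < n" for i j
    using assms that by (auto simp: nova_copy_iff inj_on_eq_iff)
  show "nova_copy G n (\<lambda>i. k ((i + a) mod n)) (\<lambda>i. d ((i + a) mod n)) w"
    using assms lt unfolding nova_copy_iff
    by (auto simp: inj_on_def inj Suc_add_mod_eq_iff)
  have "(\<lambda>i. (i + a) mod n) ` {..<n} = {..<n}"
  proof (rule endo_inj_surj)
    show "inj_on (\<lambda>i. (i + a) mod n) {..<n}" by (auto simp: inj_on_def Suc_add_mod_eq_iff)
  qed (use lt in auto)
  then have "(\<lambda>i. f ((i + a) mod n)) ` {..<n} = f ` {..<n}" for f :: "nat \<Rightarrow> 'a"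
    using image_image[of f "\<lambda>i. (i + a) mod n" "{..<n}"] by metis
  then show "copy_verts n (\<lambda>i. k ((i + a) mod n)) (\<lambda>i. d ((i + a) mod n)) w = copy_verts n k d w"
    by (simp add: copy_verts_def)
qed

text \<open>The rim is walked from \<open>k 0\<close> to \<open>k m\<close>, skipping the vertices
  outside \<open>X\<close>. A skipped stretch is bridged by a clique edge, since by the closure
  assumption every surviving \<open>d i\<close> still has both its rim neighbours. The claims about
  ends keep the induction going: \<open>last vs = k m\<close> is needed to attach
  \<open>d m\<close>, and ends in the clique are needed for bridging and for closing up.\<close>

lemma nova_copy_path:
  assumes G: "nova_copy G n k d w"
    and X: "\<And>i. i < n \<Longrightarrow> d i \<in> X \<Longrightarrow> k i \<in> X \<and> k (Suc i mod n) \<in> X"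
    and "m < n"
  shows "\<exists>vs. distinct vs \<and> successively (adjacent G) vs \<and> set vs = X \<inter> (k ` {..m} \<union> d ` {..<m}) \<and>
    (vs \<noteq> [] \<longrightarrow> hd vs \<in> k ` {..m} \<and> last vs \<in> k ` {..m}) \<and>
    (k m \<in> X \<longrightarrow> last vs = k m) \<and> (k 0 \<in> X \<longrightarrow> hd vs = k 0)"
  using \<open>m < n\<close>
proof (induction m)
  case 0
  show ?case by (rule exI[of _ "if k 0 \<in> X then [k 0] else []"]) auto
next
  case (Suc m)
  then obtain vs where vs: "distinct vs" "successively (adjacent G) vs"
    "set vs = X \<inter> (k ` {..m} \<union> d ` {..<m})"
    "vs \<noteq> [] \<Longrightarrow> hd vs \<in> k ` {..m} \<and> last vs \<in> k ` {..m}"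
    "k m \<in> X \<Longrightarrow> last vs = k m" "k 0 \<in> X \<Longrightarrow> hd vs = k 0" by auto
  have inj: "k i = k j \<longleftrightarrow> i = j" "d i = d j \<longleftrightarrow> i = j" "k i \<noteq> d j"
    if "i < n" "j < n" for i j
    using G that by (auto simp: nova_copy_iff inj_on_eq_iff)
  have new: "k (Suc m) \<notin> set vs" "d m \<notin> set vs" "k (Suc m) \<noteq> d m"
    using vs(3) Suc.prems inj(3)[symmetric] by (auto simp: inj)
  have k0: "vs \<noteq> []" if "k 0 \<in> X" using vs(3) that by auto
  consider (d) "d m \<in> X" | (k) "d m \<notin> X" "k (Suc m) \<in> X" | (none) "d m \<notin> X" "k (Suc m) \<notin> X" by blast
  then show ?case
  proof cases
    case d
    then have kX: "k m \<in> X" "k (Suc m) \<in> X" using X[of m] Suc.prems by auto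
    then have ne: "vs \<noteq> []" using vs(3) by auto
    have "distinct (vs @ [d m, k (Suc m)])" using vs(1) new by auto
    moreover have "successively (adjacent G) (vs @ [d m, k (Suc m)])"
      using vs(2,5) kX Suc.prems by (simp add: successively_append_iff nova_copy_adjacent[OF G])
    moreover have "set (vs @ [d m, k (Suc m)]) = X \<inter> (k ` {..Suc m} \<union> d ` {..<Suc m})"
      using vs(3) kX d by (auto simp: atMost_Suc lessThan_Suc)
    moreover have "hd (vs @ [d m, k (Suc m)]) \<in> k ` {..Suc m}"
      using vs(4) ne by (auto simp: atMost_Suc)
    ultimately show ?thesis using vs(6) ne by (intro exI[of _ "vs @ [d m, k (Suc m)]"]) auto
  next
    case k
    have adj: "adjacent G (last vs) (k (Suc m))" if "vs \<noteq> []"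
      using vs(4)[OF that] Suc.prems by (auto simp: nova_copy_adjacent[OF G])
    have "distinct (vs @ [k (Suc m)])" using vs(1) new by auto
    moreover have "successively (adjacent G) (vs @ [k (Suc m)])"
      using vs(2) adj by (auto simp: successively_append_iff)
    moreover have "set (vs @ [k (Suc m)]) = X \<inter> (k ` {..Suc m} \<union> d ` {..<Suc m})"
      using vs(3) k by (auto simp: atMost_Suc lessThan_Suc)
    moreover have "hd (vs @ [k (Suc m)]) \<in> k ` {..Suc m}"
      using vs(4) by (cases "vs = []") (auto simp: atMost_Suc)
    ultimately show ?thesis using vs(6) k0 by (intro exI[of _ "vs @ [k (Suc m)]"]) auto
  next
    case none
    have "set vs = X \<inter> (k ` {..Suc m} \<union> d ` {..<Suc m})"
      using vs(3) none by (auto simp: atMost_Suc lessThan_Suc)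
    then show ?thesis using vs(1,2,4,6) none(2) by (intro exI[of _ vs]) (auto simp: atMost_Suc)
  qed
qed

text \<open>Without \<open>d (n - 1)\<close> nothing has to be visited between
  \<open>k (n - 1)\<close> and \<open>k 0\<close>, so the rim path may be closed through
  \<open>w\<close> if \<open>w\<close> survives and by a clique edge otherwise. Three vertices in
  \<open>X\<close> leave at least two on the path, so its two ends differ.\<close>

lemma nova_copy_cycle_avoiding_last:
  assumes G: "nova_copy G n k d w" "verts G = copy_verts n k d w"
    and X: "\<And>i. i < n \<Longrightarrow> d i \<in> X \<Longrightarrow> k i \<in> X \<and> k (Suc i mod n) \<in> X" "X \<subseteq> verts G"
    and c: "3 \<le> card X" and last: "d (n - 1) \<notin> X"
  shows "\<exists>vs. cycle_list G vs \<and> set vs = X"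
proof -
  have n: "2 \<le> n" using G(1) by (simp add: nova_copy_iff)
  have up: "k ` {..n - 1} = k ` {..<n}" using n by (intro arg_cong[of _ _ "image k"]) auto
  have "{..<n} = insert (n - 1) {..<n - 1}" using n by auto
  then have ups: "d ` {..<n} = insert (d (n - 1)) (d ` {..<n - 1})" by (metis image_insert)
  obtain vs where vs: "distinct vs" "successively (adjacent G) vs"
    "set vs = X \<inter> (k ` {..n - 1} \<union> d ` {..<n - 1})"
    "vs \<noteq> [] \<Longrightarrow> hd vs \<in> k ` {..n - 1} \<and> last vs \<in> k ` {..n - 1}"
    using nova_copy_path[OF G(1), of X "n - 1"] X(1) n by auto
  have wn: "w \<notin> k ` {..<n} \<union> d ` {..<n}" using G(1) by (auto simp: nova_copy_iff)
  then have set: "set vs = X - {w}"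
    using vs(3) X(2) G(2) last up ups by (auto simp: copy_verts_def)
  have len: "length vs = card (X - {w})" using vs(1) set by (metis distinct_card)
  have "card X \<le> Suc (card (X - {w}))" by (auto simp: card_Diff_singleton_if)
  then have len2: "2 \<le> length vs" using len c by simp
  then obtain i j where ij: "hd vs = k i" "last vs = k j" "i < n" "j < n"
    using vs(4) up by (cases "vs = []") auto
  have "hd vs \<noteq> last vs"
  proof -
    obtain x y zs where "vs = x # y # zs" using len2 by (cases vs; cases "tl vs") auto
    then show ?thesis using vs(1) by auto
  qed
  then have neq: "i \<noteq> j" using ij by auto
  show ?thesis
  proof (cases "w \<in> X")
    case True
    have "cycle_list G (vs @ [w])"
    proof -
      have "adjacent G (last vs) w" "adjacent G w (hd vs)"
        unfolding ij(1,2) using ij(3,4) by (simp_all add: nova_copy_adjacent[OF G(1)])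
      moreover have "w \<notin> set vs" unfolding set by blast
      moreover have "vs \<noteq> []" using len2 by auto
      ultimately show ?thesis
        using vs(1,2) len2 by (simp add: cycle_list_def successively_append_iff)
    qed
    then show ?thesis using set True by (intro exI[of _ "vs @ [w]"]) auto
  next
    case False
    have "cycle_list G vs"
    proof -
      have "adjacent G (last vs) (hd vs)"
        unfolding ij(1,2) using ij(3,4) neq by (simp add: nova_copy_adjacent[OF G(1)])
      then show ?thesis using vs(1,2) len c False by (simp add: cycle_list_def)
    qed
    then show ?thesis using set False by (intro exI[of _ vs]) auto
  qed
qed

lemma nova_copy_HC_obstruction:
  assumes G: "simple_graph G" "nova_copy G n k d w" "verts G = copy_verts n k d w"
  shows "HC_obstruction G"
  unfolding HC_obstruction_def
proof (intro conjI allI impI)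
  show "simple_graph G" by fact
  show "two_connected G" by (rule nova_copy_two_connected[OF G])
  show "\<not> hamiltonian G" by (rule nova_copy_not_hamiltonian[OF G])
  have n: "2 \<le> n" using G(2) by (simp add: nova_copy_iff)
  fix H assume "induced_subgraph H G"
  then obtain X where X: "X \<subseteq> verts G" "H = induce G X" unfolding induced_subgraph_def by blast
  have "hamiltonian H" if H: "two_connected H" "H \<noteq> G"
  proof -
    have "X \<noteq> verts G" using H X induce_verts[OF G(1)] by auto
    \<comment> \<open>In the nova \<open>d i\<close> has only two neighbours, so 2-connectedness of
      the induced subgraph forces both of them to survive.\<close>
    have closed: "k i \<in> X \<and> k (Suc i mod n) \<in> X" if i: "i < n" "d i \<in> X" for i
    proof -
      obtain a b where ab: "a \<noteq> b" "adjacent H (d i) a" "adjacent H (d i) b"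
        using two_connected_two_neighbours[OF simple_graph_induce[OF G(1) X(1)]] H(1) X(2) i
        by (metis verts_induce)
      have "t \<in> {k i, k (Suc i mod n)} \<and> t \<in> X" if "adjacent H (d i) t" for t
      proof -
        have t: "adjacent G (d i) t" "t \<in> X" using that X by (auto simp: adjacent_induce)
        then have "t \<in> copy_verts n k d w" using X(1) G(3) by auto
        then obtain j where "j < n" "t = k j" using t(1) i(1)
          by (auto simp: copy_verts_def nova_copy_adjacent[OF G(2)])
        then show ?thesis using t i(1) by (auto simp: nova_copy_adjacent[OF G(2)])
      qed
      from this[OF ab(2)] this[OF ab(3)] ab(1) show ?thesis by auto
    qed
    have c: "3 \<le> card X" using H(1) X(2) by (simp add: two_connected_def)
    have "\<exists>vs. cycle_list G vs \<and> set vs = X"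
    proof (cases "\<exists>j<n. d j \<notin> X")
      case True
      then obtain j where j: "j < n" "d j \<notin> X" by blast
      let ?k = "\<lambda>i. k ((i + Suc j) mod n)" and ?d = "\<lambda>i. d ((i + Suc j) mod n)"
      show ?thesis
      proof (rule nova_copy_cycle_avoiding_last)
        show "nova_copy G n ?k ?d w" "verts G = copy_verts n ?k ?d w"
          using nova_copy_shift[OF G(2), of "Suc j"] G(3) by (simp_all only:)
        \<comment> \<open>Shifting by \<open>Suc j\<close> gives the missing vertex the index
          \<open>n - 1\<close>.\<close>
        have "(n - 1 + Suc j) mod n = j" using j n by simp
        then show "?d (n - 1) \<notin> X" using j by metis
        show "?k i \<in> X \<and> ?k (Suc i mod n) \<in> X" if "i < n" "?d i \<in> X" for i
        proof -
          have "(Suc i mod n + Suc j) mod n = Suc ((i + Suc j) mod n) mod n"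
            using mod_add_left_eq[of "Suc i" n "Suc j"] mod_Suc_eq[of "i + Suc j" n] by simp
          then show ?thesis using closed[OF _ that(2)] n by simp
        qed
      qed (fact X(1) c)+
    next
      case False
      \<comment> \<open>With every \<open>d i\<close> present, all of the clique is present too;
        only \<open>w\<close> can be missing, and the full rim is then a Hamiltonian cycle.\<close>
      then have all: "d i \<in> X" "k i \<in> X" if "i < n" for i using closed that by auto
      have "w \<notin> X"
      proof
        assume "w \<in> X"
        then have "verts G \<subseteq> X" using all G(3) by (auto simp: copy_verts_def)
        then show False using \<open>X \<noteq> verts G\<close> X(1) by blast
      qed
      have up: "k ` {..n - 1} = k ` {..<n}" using n by (intro arg_cong[of _ _ "image k"]) auto
      have "{..<n} = insert (n - 1) {..<n - 1}" using n by auto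
      then have ups: "d ` {..<n} = insert (d (n - 1)) (d ` {..<n - 1})" by (metis image_insert)
      obtain vs where vs: "distinct vs" "successively (adjacent G) vs"
        "set vs = X \<inter> (k ` {..n - 1} \<union> d ` {..<n - 1})" "last vs = k (n - 1)" "hd vs = k 0"
        using nova_copy_path[OF G(2), of X "n - 1"] closed n all by auto
      have "d (n - 1) \<notin> set vs"
      proof -
        have "k i \<noteq> d (n - 1)" if "i < n" for i using that n G(2) by (auto simp: nova_copy_iff)
        moreover have "d i \<noteq> d (n - 1)" if "i < n - 1" for i
        proof -
          have "inj_on d {..<n}" using G(2) by (simp add: nova_copy_iff)
          then show ?thesis using that n inj_on_eq_iff[of d "{..<n}" i "n - 1"] by auto
        qed
        ultimately have "d (n - 1) \<notin> k ` {..<n}" "d (n - 1) \<notin> d ` {..<n - 1}" by force+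
        then show ?thesis using vs(3) up by auto
      qed
      moreover have set: "set (vs @ [d (n - 1)]) = X"
        using vs(3) X(1) \<open>w \<notin> X\<close> G(3) up ups all n by (auto simp: copy_verts_def)
      moreover have "length (vs @ [d (n - 1)]) = card X"
        using calculation vs(1) distinct_card[of "vs @ [d (n - 1)]"] by simp
      moreover have "vs \<noteq> []" using calculation c by auto
      ultimately have "cycle_list G (vs @ [d (n - 1)])"
        using vs c n by (simp add: cycle_list_def successively_append_iff nova_copy_adjacent[OF G(2)])
      then show ?thesis using set by blast
    qed
    then show ?thesis using hamiltonian_induce_iff[OF G(1) X(1)] X(2) by simp
  qed
  then show "H = G \<or> \<not> two_connected H \<or> hamiltonian H" by blast
qed

text \<open>The subgraph induced by the copy is 2-connected and not Hamiltonian, so minimality of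
  the obstruction leaves no vertex outside it.\<close>

lemma obstruction_nova_copy:
  assumes "HC_obstruction G" "nova_copy G n k d w"
  shows "verts G = copy_verts n k d w"
proof -
  let ?X = "copy_verts n k d w"
  have G: "simple_graph G" using assms(1) by (simp add: HC_obstruction_def)
  have split: "split_copy G n (\<lambda>i j. j = i \<or> j = Suc i mod n) False k d w"
    using assms(2) by (simp add: nova_copy_def)
  have "2 \<le> n" using assms(2) by (simp add: nova_copy_def)
  then have X: "?X \<subseteq> verts G" by (intro split_copy_subset[OF G split]) auto
  have "two_connected (induce G ?X)" "\<not> hamiltonian (induce G ?X)"
    using nova_copy_two_connected[OF simple_graph_induce[OF G X] nova_copy_induce[OF assms(2) order_refl]]
      nova_copy_not_hamiltonian[OF simple_graph_induce[OF G X] nova_copy_induce[OF assms(2) order_refl]]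
    by simp_all
  then have "induce G ?X = G" using assms(1) X unfolding HC_obstruction_def induced_subgraph_def by blast
  then show ?thesis by (metis verts_induce)
qed

section \<open>The concrete suns and novas\<close>

lemma verts_sun: "verts (sun n) = {1..2 * n}"
  by (auto simp: sun_def cycle_graph_def Let_def)

lemma edges_cycle_graph_upt:
  "edges (cycle_graph [1..<m + 1]) = {{Suc i, Suc (Suc i mod m)} | i. i < m}"
proof -
  have nth: "[1..<m + 1] ! i = Suc i" if "i < m" for i
    using that by (subst nth_upt) auto
  have eq: "{[1..<m + 1] ! i, [1..<m + 1] ! (Suc i mod m)} = {Suc i, Suc (Suc i mod m)}" if "i < m" for i
    using nth[OF that] nth[of "Suc i mod m"] that by (simp del: upt_Suc)
  have "edges (cycle_graph [1..<m + 1]) = {{[1..<m + 1] ! i, [1..<m + 1] ! (Suc i mod m)} | i. i < m}"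
    unfolding cycle_graph_def by (simp del: upt_Suc)
  also have "\<dots> = {{Suc i, Suc (Suc i mod m)} | i. i < m}"
    by (rule Collect_cong) (metis eq)
  finally show ?thesis .
qed

lemma adjacent_sun:
  assumes "u \<in> {1..2 * n}" "v \<in> {1..2 * n}"
  shows "adjacent (sun n) u v \<longleftrightarrow>
    v = u mod (2 * n) + 1 \<or> u = v mod (2 * n) + 1 \<or> even u \<and> even v \<and> u \<noteq> v"
proof -
  have 1: "{u, v} \<in> edges (cycle_graph [1..<2 * n + 1]) \<longleftrightarrow>
    v = u mod (2 * n) + 1 \<or> u = v mod (2 * n) + 1"
  proof -
    have "{u, v} \<in> edges (cycle_graph [1..<2 * n + 1]) \<longleftrightarrow>
      (\<exists>i<2 * n. {u, v} = {Suc i, Suc (Suc i mod (2 * n))})"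
      unfolding edges_cycle_graph_upt by auto
    \<comment> \<open>List positions start at 0 and vertices at 1, so position \<open>i\<close>
      carries the vertex \<open>a = Suc i\<close> and the successor of vertex \<open>a\<close> is
      \<open>a mod (2 * n) + 1\<close>.\<close>
    also have "\<dots> \<longleftrightarrow> (\<exists>a\<in>{1..2 * n}. {u, v} = {a, Suc (a mod (2 * n))})"
    proof -
      have "{1..2 * n} = Suc ` {..<2 * n}"
        by (metis One_nat_def image_Suc_lessThan)
      then show ?thesis by auto
    qed
    also have "\<dots> \<longleftrightarrow> v = u mod (2 * n) + 1 \<or> u = v mod (2 * n) + 1"
      using assms by (auto simp: doubleton_eq_iff)
    finally show ?thesis .
  qed
  have 2: "{u, v} \<in> {{2 * i, 2 * j} | i j. i \<in> {1..n} \<and> j \<in> {1..n} \<and> i \<noteq> j} \<longleftrightarrow> even u \<and> even v \<and> u \<noteq> v"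
    (is "?L \<longleftrightarrow> ?R")
  proof
    assume ?R
    then obtain i j where "u = 2 * i" "v = 2 * j" by (auto elim!: evenE)
    then show ?L using \<open>?R\<close> assms by (intro CollectI exI[of _ i] exI[of _ j]) auto
  qed (auto simp: doubleton_eq_iff)
  show ?thesis using 1 2 by (auto simp: adjacent_def sun_def Let_def)
qed

lemma adjacent_add_vertex:
  "adjacent (add_vertex G X) (Some u) (Some v) \<longleftrightarrow> adjacent G u v"
  "adjacent (add_vertex G X) None (Some u) \<longleftrightarrow> u \<in> X"
  "\<not> adjacent (add_vertex G X) None None"
proof -
  have "(\<exists>e\<in>E. {Some u, Some v} = Some ` e) \<longleftrightarrow> {u, v} \<in> E" for E
  proof -
    have "{Some u, Some v} = Some ` e \<longleftrightarrow> e = {u, v}" for e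
      using inj_image_eq_iff[of Some "{u, v}" e] by auto
    then show ?thesis by auto
  qed
  then show "adjacent (add_vertex G X) (Some u) (Some v) \<longleftrightarrow> adjacent G u v"
    by (auto simp: adjacent_def add_vertex_def image_iff)
qed (auto simp: adjacent_def add_vertex_def doubleton_eq_iff)

lemma simple_graph_add_vertex:
  assumes "simple_graph G" "X \<subseteq> verts G"
  shows "simple_graph (add_vertex G X)"
  using assms by (auto simp: simple_graph_def add_vertex_def card_image)

lemma simple_graph_sun:
  assumes "1 \<le> n"
  shows "simple_graph (sun n)"
proof -
  have "e \<subseteq> {1..2 * n} \<and> card e = 2" if e: "e \<in> edges (cycle_graph [1..<2 * n + 1])" for e
  proof -
    obtain i where i: "i < 2 * n" "e = {Suc i, Suc (Suc i mod (2 * n))}"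
      using e unfolding edges_cycle_graph_upt by blast
    have "Suc i mod (2 * n) \<noteq> i"
    proof (cases "Suc i = 2 * n")
      case True
      then have "i \<noteq> 0" by presburger
      then show ?thesis using True by simp
    qed (use i(1) in auto)
    moreover have "Suc (Suc i mod (2 * n)) \<le> 2 * n" using assms by (simp add: Suc_le_eq)
    ultimately show ?thesis using i by (simp add: Suc_le_eq)
  qed
  moreover have "e \<subseteq> {1..2 * n} \<and> card e = 2"
    if "e \<in> {{2 * i, 2 * j} | i j. i \<in> {1..n} \<and> j \<in> {1..n} \<and> i \<noteq> j}" for e
    using that by auto
  ultimately have "\<forall>e\<in>edges (sun n). e \<subseteq> {1..2 * n} \<and> card e = 2"
    unfolding sun_def Let_def snd_conv by blast
  then show ?thesis unfolding simple_graph_def verts_sun by simp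
qed

lemma simple_graph_nova: "1 \<le> n \<Longrightarrow> simple_graph (nova n)"
  unfolding nova_def by (rule simple_graph_add_vertex[OF simple_graph_sun]) (auto simp: verts_sun)

text \<open>Choosing \<open>d 0\<close> as the vertex 1 makes its rim predecessor, the vertex
  \<open>2 * n\<close>, play the role of \<open>k 0\<close>; all other \<open>k i\<close> are the
  vertices \<open>2 * i\<close>.\<close>

lemma nova_copy_nova:
  assumes "2 \<le> n"
  defines "k \<equiv> \<lambda>i. Some (if i = 0 then 2 * n else 2 * i)" and "d \<equiv> \<lambda>i. Some (2 * i + 1)"
  shows "nova_copy (nova n) n k d None" "verts (nova n) = copy_verts n k d None"
proof -
  have adj: "adjacent (nova n) (Some u) (Some v) \<longleftrightarrow>
      v = u mod (2 * n) + 1 \<or> u = v mod (2 * n) + 1 \<or> even u \<and> even v \<and> u \<noteq> v"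
    if "u \<in> {1..2 * n}" "v \<in> {1..2 * n}" for u v
    using adjacent_sun[OF that] by (simp add: nova_def adjacent_add_vertex)
  have adjN: "adjacent (nova n) None (Some u) \<longleftrightarrow> even u" if "u \<in> {1..2 * n}" for u
    using that by (auto simp: nova_def adjacent_add_vertex elim!: evenE)
  have NN: "\<not> adjacent (nova n) None None" by (simp add: nova_def adjacent_add_vertex)
  have dd: "\<not> adjacent (nova n) (d i) (d j)" if "i < n" "j < n" for i j
  proof -
    have "(2 * i + 1) mod (2 * n) = 2 * i + 1" if "i < n" for i using that by simp
    then show ?thesis unfolding d_def using that adj[of "2 * i + 1" "2 * j + 1"] by simp presburger
  qed
  have dk: "adjacent (nova n) (d i) (k j) \<longleftrightarrow> j = i \<or> j = Suc i mod n" if "i < n" "j < n" for i j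
  proof -
    have m: "(2 * i + 1) mod (2 * n) = 2 * i + 1" using that by simp
    let ?v = "if j = 0 then 2 * n else 2 * j"
    have m2: "?v mod (2 * n) = 2 * j" using that by simp
    have "adjacent (nova n) (d i) (k j) \<longleftrightarrow> ?v = 2 * i + 1 + 1 \<or> 2 * i + 1 = 2 * j + 1"
      unfolding d_def k_def using that adj[of "2 * i + 1" ?v] m m2 by simp
    also have "\<dots> \<longleftrightarrow> j = i \<or> j = Suc i mod n"
      using that by (cases "Suc i = n") auto
    finally show ?thesis .
  qed
  have kk: "adjacent (nova n) (k i) (k j) \<longleftrightarrow> i \<noteq> j" if "i < n" "j < n" for i j
  proof -
    let ?u = "if i = 0 then 2 * n else 2 * i" and ?v = "if j = 0 then 2 * n else 2 * j"
    have m: "?u mod (2 * n) = 2 * i" "?v mod (2 * n) = 2 * j" using that by simp_all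
    have "even ?u" "even ?v" by simp_all
    then have "?v \<noteq> 2 * i + 1" "?u \<noteq> 2 * j + 1" by presburger+
    moreover have "?u \<noteq> ?v \<longleftrightarrow> i \<noteq> j" using that by auto
    ultimately show ?thesis
      unfolding k_def using that adj[of ?u ?v] m \<open>even ?u\<close> \<open>even ?v\<close> by auto
  qed
  have kd: "k i \<noteq> d j" for i j by (simp add: k_def d_def) presburger
  have "inj_on k {..<n}" "inj_on d {..<n}" by (auto simp: inj_on_def k_def d_def split: if_splits)
  moreover have "adjacent (nova n) None (k i)" "\<not> adjacent (nova n) None (d i)" if "i < n" for i
    unfolding k_def d_def using adjN that by auto
  ultimately show "nova_copy (nova n) n k d None"
    using assms(1) kk dk dd kd NN by (auto simp: nova_copy_iff) (auto simp: k_def d_def)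
  have "{1..2 * n} = (\<lambda>i. if i = 0 then 2 * n else 2 * i) ` {..<n} \<union> (\<lambda>i. 2 * i + 1) ` {..<n}" (is "?L = ?R")
  proof
    show "?R \<subseteq> ?L" using assms(1) by auto
    show "?L \<subseteq> ?R"
    proof
      fix x assume x: "x \<in> ?L"
      show "x \<in> ?R"
      proof (cases "even x")
        case True
        then obtain y where y: "x = 2 * y" by (elim evenE)
        show ?thesis
        proof (cases "y = n")
          case True
          then show ?thesis using y assms(1) by (intro UnI1 image_eqI[of _ _ 0]) auto
        next
          case False
          then show ?thesis using y x by (intro UnI1 image_eqI[of _ _ y]) auto
        qed
      next
        case False
        then obtain y where "x = 2 * y + 1" by (elim oddE)
        then show ?thesis using x by (intro UnI2 image_eqI[of _ _ y]) auto
      qed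
    qed
  qed
  then have "Some ` {1..2 * n} = k ` {..<n} \<union> d ` {..<n}"
    by (simp only: k_def d_def image_Un image_image)
  then show "verts (nova n) = copy_verts n k d None"
    by (simp add: nova_def add_vertex_def copy_verts_def verts_sun)
qed

section \<open>The snare\<close>

text \<open>The triangle of the net is \<open>k\<close>, each \<open>d i\<close> is pendant at
  \<open>k i\<close>, and the flag \<open>True\<close> makes the added vertex adjacent to the
  pendant vertices as well.\<close>

definition snare_copy :: "'a graph \<Rightarrow> (nat \<Rightarrow> 'a) \<Rightarrow> (nat \<Rightarrow> 'a) \<Rightarrow> 'a \<Rightarrow> bool" where
  "snare_copy G k d w \<longleftrightarrow> split_copy G 3 (\<lambda>i j. j = i) True k d w"

lemmas snare_copy_iff = snare_copy_def[unfolded split_copy_def]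

lemma snare_copy_adjacent:
  assumes "snare_copy G k d w" "i < 3"
  shows "j < 3 \<Longrightarrow> adjacent G (k i) (k j) \<longleftrightarrow> i \<noteq> j"
    and "j < 3 \<Longrightarrow> \<not> adjacent G (d i) (d j)"
    and "j < 3 \<Longrightarrow> adjacent G (d i) (k j) \<longleftrightarrow> j = i"
    and "j < 3 \<Longrightarrow> adjacent G (k j) (d i) \<longleftrightarrow> j = i"
    and "adjacent G w (k i)" "adjacent G (k i) w" "adjacent G w (d i)" "adjacent G (d i) w"
proof -
  note adj = split_copy_adjacent[OF assms(1)[unfolded snare_copy_def] assms(2)]
  show "j < 3 \<Longrightarrow> adjacent G (k i) (k j) \<longleftrightarrow> i \<noteq> j" "j < 3 \<Longrightarrow> \<not> adjacent G (d i) (d j)"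
    "j < 3 \<Longrightarrow> adjacent G (d i) (k j) \<longleftrightarrow> j = i"
    "j < 3 \<Longrightarrow> adjacent G (k j) (d i) \<longleftrightarrow> j = i"
    "adjacent G w (k i)" "adjacent G (k i) w" "adjacent G w (d i)" "adjacent G (d i) w"
    using adj by simp_all
qed

lemma snare_copy_neighbours:
  assumes G: "snare_copy G k d w" "verts G = copy_verts 3 k d w"
    and "i < 3" "adjacent G (d i) t" "t \<in> verts G"
  shows "t = w \<or> t = k i"
  using assms(2-) by (auto simp: copy_verts_def snare_copy_adjacent[OF G(1)])

lemma snare_copy_two_connected:
  assumes G: "simple_graph G" "snare_copy G k d w" "verts G = copy_verts 3 k d w"
  shows "two_connected G"
proof (rule two_connected_split)
  let ?K = "insert w (k ` {..<3})"
  have neq: "w \<noteq> k i" if "i < 3" for i using G(2) that by (auto simp: snare_copy_iff)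
  have k01: "k 0 \<noteq> k 1" using G(2) inj_on_eq_iff[of k "{..<3}" 0 1] by (simp add: snare_copy_iff)
  show "clique G ?K"
    using G(3) by (auto simp: clique_def copy_verts_def snare_copy_adjacent[OF G(2)])
  show "w \<in> ?K" "k 0 \<in> ?K" "w \<noteq> k 0" using neq by auto
  have "{w, k 0, k 1} \<subseteq> verts G" using G(3) by (auto simp: copy_verts_def)
  moreover have "card {w, k 0, k 1} = 3" using neq[of 0] neq[of 1] k01 by simp
  ultimately show "3 \<le> card (verts G)" using G(1) by (metis card_mono simple_graph_def)
  fix s assume "s \<in> verts G - ?K"
  then obtain i where i: "i < 3" "s = d i" using G(3) by (auto simp: copy_verts_def)
  then have "adjacent G s w" "adjacent G s (k i)" by (simp_all add: snare_copy_adjacent[OF G(2)])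
  then show "\<exists>a\<in>?K. \<exists>b\<in>?K. a \<noteq> b \<and> adjacent G s a \<and> adjacent G s b"
    using neq[OF i(1)] i(1) by blast
qed

text \<open>Each \<open>d i\<close> has degree two with \<open>w\<close> as a neighbour, so a
  Hamiltonian cycle would have to place all three of them next to \<open>w\<close>, which has only
  two cycle neighbours.\<close>

lemma snare_copy_not_hamiltonian:
  assumes G: "simple_graph G" "snare_copy G k d w" "verts G = copy_verts 3 k d w"
  shows "\<not> hamiltonian G"
proof
  assume "hamiltonian G"
  then obtain vs where vs: "cycle_list G vs" "set vs = verts G"
    using hamiltonian_iff_cycle_list[OF G(1)] by blast
  have len: "2 \<le> length vs" and dist: "distinct vs" using vs(1) by (auto simp: cycle_list_def)
  have *: "cyc_next vs (d i) w \<or> cyc_next vs w (d i)" if i: "i < 3" for i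
  proof -
    have "d i \<in> set vs" using vs(2) G(3) i by (auto simp: copy_verts_def)
    then obtain a b where ab: "cyc_next vs (d i) a" "cyc_next vs b (d i)"
      using cyc_next_ex[OF _ len] cyc_prev_ex[OF _ len] by metis
    then have "a \<noteq> b" using cyc_next_neq_prev[OF vs(1)] by blast
    moreover have "adjacent G (d i) a" "adjacent G (d i) b"
      using cyc_next_adjacent[OF vs(1)] ab by (auto simp: adjacent_sym[of G "d i" b])
    then have "a = w \<or> a = k i" "b = w \<or> b = k i"
      using snare_copy_neighbours[OF G(2,3) i] adjacent_verts[OF G(1)] by blast+
    ultimately show ?thesis using ab by blast
  qed
  have "inj_on d {..<3}" using G(2) by (simp add: snare_copy_iff)
  then have "d 0 \<noteq> d 1" "d 0 \<noteq> d 2" "d 1 \<noteq> d 2"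
    by (simp_all add: inj_on_eq_iff)
  then show False
    using *[of 0] *[of 1] *[of 2] cyc_next_unique[OF dist] cyc_prev_unique[OF dist]
    by (simp, metis)
qed

lemma snare_copy_HC_obstruction:
  assumes G: "simple_graph G" "snare_copy G k d w" "verts G = copy_verts 3 k d w"
  shows "HC_obstruction G"
  unfolding HC_obstruction_def
proof (intro conjI allI impI)
  show "simple_graph G" by fact
  show "two_connected G" by (rule snare_copy_two_connected[OF G])
  show "\<not> hamiltonian G" by (rule snare_copy_not_hamiltonian[OF G])
  fix H assume "induced_subgraph H G"
  then obtain X where X: "X \<subseteq> verts G" "H = induce G X" unfolding induced_subgraph_def by blast
  have "hamiltonian H" if H: "two_connected H" "H \<noteq> G"
  proof -
    have "X \<noteq> verts G" using H X induce_verts[OF G(1)] by auto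
    have closed: "w \<in> X \<and> k i \<in> X" if i: "i < 3" "d i \<in> X" for i
    proof -
      obtain a b where ab: "a \<noteq> b" "adjacent H (d i) a" "adjacent H (d i) b"
        using two_connected_two_neighbours[OF simple_graph_induce[OF G(1) X(1)]] H(1) X(2) i
        by (metis verts_induce)
      have "t \<in> {w, k i} \<and> t \<in> X" if "adjacent H (d i) t" for t
        using that X snare_copy_neighbours[OF G(2,3) i(1)] by (auto simp: adjacent_induce)
      from this[OF ab(2)] this[OF ab(3)] ab(1) show ?thesis by auto
    qed
    have c: "3 \<le> card X" using H(1) X(2) by (simp add: two_connected_def)
    \<comment> \<open>If all three pendants survived, so would all their neighbours, that is, the
      whole snare.\<close>
    have "\<exists>i<3. d i \<notin> X"
    proof (rule ccontr)
      assume "\<not> (\<exists>i<3. d i \<notin> X)"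
      then have "w \<in> X" "\<forall>i<3. k i \<in> X \<and> d i \<in> X" using closed[of 0] closed by auto
      then have "verts G \<subseteq> X" using G(3) by (auto simp: copy_verts_def)
      then show False using \<open>X \<noteq> verts G\<close> X(1) by blast
    qed
    then obtain i where i: "i < 3" "d i \<notin> X" by blast
    obtain j l where jl: "j < 3" "l < 3" "i \<noteq> j" "i \<noteq> l" "j \<noteq> l" "{..<3} = {i, j, l}"
    proof -
      have e: "{..<3} = {0, 1, 2::nat}" by auto
      consider "i = 0" | "i = 1" | "i = 2" using i(1) by linarith
      then show thesis
      proof cases
        case 1 then show thesis using e by (intro that[of 1 2]) auto
      next
        case 2 then show thesis using e by (intro that[of 0 2]) auto
      next
        case 3 then show thesis using e by (intro that[of 0 1]) auto
      qed
    qed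
    \<comment> \<open>A Hamiltonian cycle of the snare without \<open>d i\<close>. Filtering
      preserves adjacency of consecutive entries: the vertices other than pendants form a clique,
      and a surviving pendant keeps both its neighbours.\<close>
    let ?l = "[k j, d j, w, d l, k l, k i]"
    let ?vs = "filter (\<lambda>v. v \<in> X) ?l"
    have V: "verts G = insert (d i) (set ?l)" using G(3) jl(6) by (auto simp: copy_verts_def)
    have "distinct ?l"
    proof -
      have "k a = k b \<longleftrightarrow> a = b" "d a = d b \<longleftrightarrow> a = b" "k a \<noteq> d b" "k a \<noteq> w" "d a \<noteq> w"
        if "a < 3" "b < 3" for a b
        using G(2) that by (auto simp: snare_copy_iff inj_on_eq_iff)
      from this[of i j] this[of i l] this[of j l] this[of j j] this[of l l] this[of l j] i(1) jl
      show ?thesis by auto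
    qed
    then have d: "distinct ?vs" by (rule distinct_filter)
    have set: "set ?vs = X" using V X(1) i(2) by auto
    have len: "3 \<le> length ?vs" using d set c by (metis distinct_card)
    have adj: "adjacent G (k j) (d j)" "adjacent G (d j) w" "adjacent G w (d l)" "adjacent G (d l) (k l)"
      "adjacent G (k l) (k i)" "adjacent G (k i) (k j)" "adjacent G (k j) w" "adjacent G w (k l)"
      "adjacent G w (k i)" "adjacent G (k i) w" "adjacent G (k j) (k l)" "adjacent G (k i) (k l)" "adjacent G (k l) (k j)"
      "adjacent G (k j) (k i)" "adjacent G w (k j)" "adjacent G (k l) w"
      using i(1) jl by (simp_all add: snare_copy_adjacent[OF G(2)])
    have "successively (adjacent G) ?vs \<and> adjacent G (last ?vs) (hd ?vs)"
      using len closed[OF jl(1)] closed[OF jl(2)] adj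
      by (cases "k j \<in> X"; cases "d j \<in> X"; cases "w \<in> X"; cases "d l \<in> X"; cases "k l \<in> X"; cases "k i \<in> X")
        simp_all
    then have "cycle_list G ?vs" using d len by (simp only: cycle_list_def)
    then show ?thesis using hamiltonian_induce_iff[OF G(1) X(1)] X(2) set by metis
  qed
  then show "H = G \<or> \<not> two_connected H \<or> hamiltonian H" by blast
qed

lemma obstruction_snare_copy:
  assumes "HC_obstruction G" "snare_copy G k d w"
  shows "verts G = copy_verts 3 k d w"
proof -
  let ?X = "copy_verts 3 k d w"
  have G: "simple_graph G" using assms(1) by (simp add: HC_obstruction_def)
  have X: "?X \<subseteq> verts G"
    by (rule split_copy_subset[OF G assms(2)[unfolded snare_copy_def]]) auto
  have copy: "snare_copy (induce G ?X) k d w"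
    using assms(2) unfolding snare_copy_def by (intro split_copy_induce) auto
  have "two_connected (induce G ?X)" "\<not> hamiltonian (induce G ?X)"
    using snare_copy_two_connected[OF simple_graph_induce[OF G X] copy]
      snare_copy_not_hamiltonian[OF simple_graph_induce[OF G X] copy] by simp_all
  then have "induce G ?X = G" using assms(1) X unfolding HC_obstruction_def induced_subgraph_def by blast
  then show ?thesis by (metis verts_induce)
qed

lemma simple_graph_snare: "simple_graph snare"
  unfolding snare_def by (rule simple_graph_add_vertex) (auto simp: simple_graph_def net_def)

lemma snare_copy_snare:
  defines "k \<equiv> \<lambda>i. Some (if i = 0 then net_a' else if i = 1 then net_b' else net_c')"
    and "d \<equiv> \<lambda>i. Some (if i = 0 then net_a else if i = 1 then net_b else net_c)"
  shows "snare_copy snare k d None" "verts snare = copy_verts 3 k d None"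
proof -
  have e: "{..<3} = {0, 1, 2::nat}" by auto
  then have lt: "(\<forall>i<3. P i) \<longleftrightarrow> P 0 \<and> P 1 \<and> P 2" for P :: "nat \<Rightarrow> bool"
    by (metis insert_iff lessThan_iff singletonD)
  show "verts snare = copy_verts 3 k d None"
    unfolding e copy_verts_def by (auto simp: snare_def add_vertex_def net_def k_def d_def)
  show "snare_copy snare k d None"
    unfolding snare_copy_iff lt e
    by (simp add: snare_def adjacent_add_vertex k_def d_def inj_on_def)
      (simp add: net_def adjacent_def doubleton_eq_iff)
qed

section \<open>Split obstructions\<close>

text \<open>The setting to be refuted. \<open>K_nbr\<close> comes from choosing \<open>S\<close>
  maximal; the last two assumptions express that \<open>G\<close> is isomorphic to no nova and not
  to the snare, strengthened to induced copies by minimality.\<close>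

locale copy_free_split_obstruction =
  fixes G :: "'a graph" and S K :: "'a set"
  assumes obs: "HC_obstruction G"
    and V: "S \<union> K = verts G" and disj: "S \<inter> K = {}"
    and st: "stable_set G S" and cl: "clique G K"
    and K_nbr: "\<And>y. y \<in> K \<Longrightarrow> \<exists>s\<in>S. adjacent G s y"
    and no_nova: "\<And>n k d w. \<not> nova_copy G n k d w"
    and no_snare: "\<And>k d w. \<not> snare_copy G k d w"
begin

lemma simple: "simple_graph G" and two_conn: "two_connected G"
  using obs by (simp_all add: HC_obstruction_def)

lemma fin: "finite (verts G)" using simple by (simp add: simple_graph_def)

lemma KK: "u \<in> K \<Longrightarrow> v \<in> K \<Longrightarrow> u \<noteq> v \<Longrightarrow> adjacent G u v"
  using cl by (simp add: clique_def)

lemma SS: "u \<in> S \<Longrightarrow> v \<in> S \<Longrightarrow> \<not> adjacent G u v"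
  using st by (simp add: stable_set_def)

lemma SK: "s \<in> S \<Longrightarrow> adjacent G s v \<Longrightarrow> v \<in> K"
  using SS V adjacent_verts(2)[OF simple] by blast

lemma irrefl: "\<not> adjacent G v v"
  using adjacent_verts(3)[OF simple] by blast

lemma not_ham: "\<not> (cycle_list G vs \<and> set vs = verts G)"
  using obs hamiltonian_iff_cycle_list[OF simple] by (auto simp: HC_obstruction_def)

lemma proper_ham:
  assumes "X \<subseteq> verts G" "X \<noteq> verts G" "two_connected (induce G X)"
  obtains vs where "cycle_list G vs" "set vs = X"
proof -
  have "induced_subgraph (induce G X) G" using assms(1) by (auto simp: induced_subgraph_def)
  moreover have "induce G X \<noteq> G" using assms(2) by (metis verts_induce)
  ultimately have "hamiltonian (induce G X)"
    using obs assms(3) unfolding HC_obstruction_def by blast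
  then show thesis using that hamiltonian_induce_iff[OF simple assms(1)] by blast
qed

section \<open>Forbidden local configurations\<close>

text \<open>These five vertices form a 2-nova with clique \<open>y\<close>, \<open>u\<close>. The
  assumptions on \<open>a\<close>, \<open>b\<close>, \<open>c\<close> are adjacencies rather than
  membership in \<open>S\<close>, because in applications one of the three lies in
  \<open>K\<close>.\<close>

lemma no_common_pair:
  assumes "y \<in> K" "u \<in> K" "y \<noteq> u" "a \<noteq> b" "a \<noteq> c" "b \<noteq> c"
    and "adjacent G a y" "adjacent G a u" "adjacent G b y" "adjacent G b u" "adjacent G c y" "adjacent G c u"
    and "\<not> adjacent G a b" "\<not> adjacent G a c" "\<not> adjacent G b c"
  shows False
proof -
  let ?k = "\<lambda>i::nat. if i = 0 then y else u" and ?d = "\<lambda>i::nat. if i = 0 then a else b"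
  have lt: "(\<forall>i<2. P i) \<longleftrightarrow> P 0 \<and> P 1" for P :: "nat \<Rightarrow> bool"
    by (metis One_nat_def less_2_cases less_2_cases_iff)
  have e: "{..<2} = {0, 1::nat}" by auto
  have neq: "y \<noteq> a" "y \<noteq> b" "u \<noteq> a" "u \<noteq> b" "y \<noteq> c" "u \<noteq> c" using assms irrefl by auto
  have sym: "adjacent G y u" "adjacent G u y" "\<not> adjacent G b a" "\<not> adjacent G c a" "\<not> adjacent G c b"
    using assms KK by (auto simp: adjacent_sym)
  have "nova_copy G 2 ?k ?d c"
    unfolding nova_copy_iff lt e using assms neq sym irrefl by (simp add: inj_on_def)
  then show False using no_nova by blast
qed

text \<open>A snare with centre \<open>x\<close>: three stable neighbours of \<open>x\<close>, each
  with a neighbour in \<open>K\<close> of its own.\<close>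

lemma no_private_triple:
  assumes K: "x \<in> K" "y1 \<in> K" "y2 \<in> K" "y3 \<in> K"
    and dist: "x \<noteq> y1" "x \<noteq> y2" "x \<noteq> y3" "y1 \<noteq> y2" "y1 \<noteq> y3" "y2 \<noteq> y3"
    and S: "d1 \<in> S" "d2 \<in> S" "d3 \<in> S"
    and x: "adjacent G d1 x" "adjacent G d2 x" "adjacent G d3 x"
    and adj: "adjacent G d1 y1" "adjacent G d2 y2" "adjacent G d3 y3"
      "\<not> adjacent G d1 y2" "\<not> adjacent G d1 y3" "\<not> adjacent G d2 y1"
      "\<not> adjacent G d2 y3" "\<not> adjacent G d3 y1" "\<not> adjacent G d3 y2"
  shows False
proof -
  let ?k = "\<lambda>i::nat. if i = 0 then y1 else if i = 1 then y2 else y3"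
    and ?d = "\<lambda>i::nat. if i = 0 then d1 else if i = 1 then d2 else d3"
  have e: "{..<3} = {0, 1, 2::nat}" by auto
  then have lt: "(\<forall>i<3. P i) \<longleftrightarrow> P 0 \<and> P 1 \<and> P 2" for P :: "nat \<Rightarrow> bool"
    by (metis insert_iff lessThan_iff singletonD)
  have d: "d1 \<noteq> d2" "d1 \<noteq> d3" "d2 \<noteq> d3" using adj by auto
  have kd: "k \<noteq> d" if "k \<in> K" "d \<in> S" for k d using that disj by auto
  have ne: "y1 \<noteq> d1" "y1 \<noteq> d2" "y1 \<noteq> d3" "y2 \<noteq> d1" "y2 \<noteq> d2" "y2 \<noteq> d3" "y3 \<noteq> d1" "y3 \<noteq> d2" "y3 \<noteq> d3"
    "d1 \<noteq> x" "d2 \<noteq> x" "d3 \<noteq> x"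
    using kd K S by blast+
  have yy: "adjacent G y1 y2" "adjacent G y2 y1" "adjacent G y1 y3" "adjacent G y3 y1"
    "adjacent G y2 y3" "adjacent G y3 y2" "adjacent G x y1" "adjacent G x y2" "adjacent G x y3"
    using KK K dist by metis+
  have dd: "\<not> adjacent G u v" if "u \<in> {d1, d2, d3}" "v \<in> {d1, d2, d3}" for u v using that SS S by auto
  have xd: "adjacent G x d1" "adjacent G x d2" "adjacent G x d3" using x by (auto simp: adjacent_sym)
  have "snare_copy G ?k ?d x"
    unfolding snare_copy_iff lt e
    using adj x xd d ne yy dd dist dist[symmetric] irrefl by (simp add: inj_on_def)
  then show False using no_snare by blast
qed

lemma two_nbrs:
  assumes "s \<in> S"
  obtains a b where "a \<in> K" "b \<in> K" "a \<noteq> b" "adjacent G s a" "adjacent G s b"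
proof -
  have "s \<in> verts G" using assms V by auto
  then obtain a b where "a \<noteq> b" "adjacent G s a" "adjacent G s b"
    using two_connected_two_neighbours[OF simple two_conn] by metis
  then show thesis using that SK assms by blast
qed

text \<open>If \<open>K\<close> had just two vertices, every vertex of \<open>S\<close> would see
  both. One or two vertices in \<open>S\<close> then give a Hamiltonian triangle or 4-cycle, and
  three give a 2-nova.\<close>

lemma card_K: "3 \<le> card K"
proof (cases "S = {}")
  case True
  then have "K = verts G" using V by simp
  then show ?thesis using two_conn by (simp add: two_connected_def)
next
  case False
  then obtain s where s: "s \<in> S" by blast
  then obtain a b where ab: "a \<in> K" "b \<in> K" "a \<noteq> b" "adjacent G s a" "adjacent G s b"
    using two_nbrs by metis
  show ?thesis
  proof (rule ccontr)
    assume "\<not> 3 \<le> card K"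
    moreover have "finite K" using V fin by (metis finite_Un)
    moreover have "card {a, b} = 2" using ab by simp
    ultimately have "{a, b} = K" using ab by (intro card_seteq) auto
    then have adj: "adjacent G t a" "adjacent G t b" if "t \<in> S" for t
      using two_nbrs[OF that] by (metis empty_iff insert_iff)+
    show False
    proof (cases "S = {s}")
      case True
      have "cycle_list G [a, s, b]"
        using ab s disj KK[of b a] by (auto simp: cycle_list_def adjacent_sym[of G a s])
      moreover have "set [a, s, b] = verts G" using True \<open>{a, b} = K\<close> V by auto
      ultimately show False using not_ham by blast
    next
      case False
      then obtain t where t: "t \<in> S" "t \<noteq> s" using s by blast
      show False
      proof (cases "S = {s, t}")
        case True
        have "cycle_list G [a, s, b, t]"
          using ab s t disj adj[OF t(1)]
          by (auto simp: cycle_list_def adjacent_sym[of G a s] adjacent_sym[of G b t])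
        moreover have "set [a, s, b, t] = verts G" using True \<open>{a, b} = K\<close> V by auto
        ultimately show False using not_ham by blast
      next
        case False
        then obtain u where u: "u \<in> S" "u \<noteq> s" "u \<noteq> t" using s t by blast
        show False
          by (rule no_common_pair[of a b s t u]) (use ab adj s t u SS in auto)
      qed
    qed
  qed
qed

text \<open>The remaining vertices of \<open>S\<close> keep all their neighbours, which lie in
  \<open>K\<close>, so the deletion preserves 2-connectedness.\<close>

lemma ham_minus_S:
  assumes "s \<in> S"
  obtains vs where "cycle_list G vs" "set vs = verts G - {s}"
proof (rule proper_ham)
  have sK: "s \<notin> K" using assms disj by blast
  show "verts G - {s} \<noteq> verts G" using assms V by blast
  obtain a b where ab: "a \<in> K" "b \<in> K" "a \<noteq> b" using two_nbrs[OF assms] by metis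
  show "two_connected (induce G (verts G - {s}))"
  proof (rule two_connected_split[of _ K a b])
    show "clique (induce G (verts G - {s})) K"
      using sK V KK by (auto simp: clique_def adjacent_induce)
    have "K \<subseteq> verts G - {s}" using V sK by auto
    then have "card K \<le> card (verts G - {s})" using fin by (intro card_mono) auto
    then show "3 \<le> card (verts (induce G (verts G - {s})))" using card_K by simp
    fix t assume "t \<in> verts (induce G (verts G - {s})) - K"
    then have t: "t \<in> S" "t \<noteq> s" using V by auto
    obtain a b where "a \<in> K" "b \<in> K" "a \<noteq> b" "adjacent G t a" "adjacent G t b"
      using two_nbrs[OF t(1)] by metis
    moreover have "K \<subseteq> verts G - {s}" "t \<in> verts G - {s}" using V sK t by auto
    ultimately show "\<exists>a\<in>K. \<exists>b\<in>K. a \<noteq> b \<and> adjacent (induce G (verts G - {s})) t a \<and>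
        adjacent (induce G (verts G - {s})) t b"
      unfolding adjacent_induce by blast
  qed (use ab in auto)
qed (use that in auto)

text \<open>Otherwise deleting \<open>y\<close> would leave a 2-connected graph, and \<open>y\<close> fits into its Hamiltonian
  cycle right after any neighbour in \<open>S\<close>.\<close>

lemma degree_two_nbr:
  assumes y: "y \<in> K"
  obtains d z where "d \<in> S" "z \<in> K" "z \<noteq> y" "adjacent G d y" "adjacent G d z"
    "\<And>v. adjacent G d v \<Longrightarrow> v = y \<or> v = z"
proof (rule ccontr)
  note found = that
  assume none: "\<not> thesis"
  \<comment> \<open>A vertex of \<open>S\<close> adjacent to \<open>y\<close> has, by
    \<open>none\<close>, a third neighbour besides \<open>y\<close> and \<open>z\<close>, so two
    remain after deleting \<open>y\<close>.\<close>
  have two: "\<exists>a\<in>K - {y}. \<exists>b\<in>K - {y}. a \<noteq> b \<and> adjacent G s a \<and> adjacent G s b" if s: "s \<in> S" for s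
  proof -
    obtain a b where ab: "a \<in> K" "b \<in> K" "a \<noteq> b" "adjacent G s a" "adjacent G s b"
      using two_nbrs[OF s] by metis
    have "\<exists>z\<in>K. z \<noteq> y \<and> adjacent G s z" using ab by metis
    then obtain z where z: "z \<in> K" "z \<noteq> y" "adjacent G s z" by blast
    show ?thesis
    proof (cases "adjacent G s y")
      case True
      then obtain v where "adjacent G s v" "v \<noteq> y" "v \<noteq> z"
        using found[OF s z(1,2) True z(3)] none by blast
      then show ?thesis using z SK[OF s] by blast
    next
      case False
      then show ?thesis using ab by blast
    qed
  qed
  obtain s where s: "s \<in> S" "adjacent G s y" using K_nbr[OF y] by blast
  then have sK: "s \<notin> K" using disj by blast
  obtain a b where ab: "a \<in> K - {y}" "b \<in> K - {y}" "a \<noteq> b" using two[OF s(1)] by blast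
  obtain vs where vs: "cycle_list G vs" "set vs = verts G - {y}"
  proof (rule proper_ham)
    show "verts G - {y} \<noteq> verts G" using y V by blast
    show "two_connected (induce G (verts G - {y}))"
    proof (rule two_connected_split[of _ "K - {y}" a b])
      show "clique (induce G (verts G - {y})) (K - {y})"
        using V KK by (auto simp: clique_def adjacent_induce)
      have "{a, b, s} \<subseteq> verts G - {y}" using ab s y V sK by auto
      then have "card {a, b, s} \<le> card (verts G - {y})" using fin by (intro card_mono) auto
      moreover have "a \<noteq> s" "b \<noteq> s" using ab sK by auto
      then have "card {a, b, s} = 3" using ab(3) by simp
      ultimately show "3 \<le> card (verts (induce G (verts G - {y})))" by simp
      fix t assume "t \<in> verts (induce G (verts G - {y})) - (K - {y})"
      then have t: "t \<in> S" "t \<in> verts G - {y}" using V by auto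
      have "K - {y} \<subseteq> verts G - {y}" using V by auto
      then show "\<exists>a\<in>K - {y}. \<exists>b\<in>K - {y}. a \<noteq> b \<and> adjacent (induce G (verts G - {y})) t a \<and>
          adjacent (induce G (verts G - {y})) t b"
        using two[OF t(1)] t(2) unfolding adjacent_induce by blast
    qed (use ab in auto)
  qed auto
  have "s \<in> set vs" using s(1) V vs(2) y sK by auto
  moreover have "2 \<le> length vs" using vs(1) by (simp add: cycle_list_def)
  ultimately obtain u where u: "cyc_next vs s u" using cyc_next_ex by metis
  then have "u \<in> K" using SK[OF s(1)] cyc_next_adjacent[OF vs(1)] by blast
  moreover have "u \<noteq> y" using cyc_next_set[OF u] vs(2) by auto
  ultimately have "adjacent G y u" using KK y by metis
  moreover have "adjacent G y s" using s(2) by (simp add: adjacent_sym)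
  ultimately obtain vs' where "cycle_list G vs'" "set vs' = insert y (set vs)"
    using cycle_list_insert[OF vs(1) u] vs(2) by blast
  moreover have "insert y (set vs) = verts G" using vs(2) y V by auto
  ultimately show False using not_ham by metis
qed

section \<open>Vertices of \<open>S\<close> complete to \<open>K\<close>\<close>

definition complete :: "'a \<Rightarrow> bool" where
  "complete s \<longleftrightarrow> s \<in> S \<and> (\<forall>y\<in>K. adjacent G s y)"

text \<open>A vertex \<open>w\<close> of \<open>K\<close> missed by \<open>s\<close> is also missed
  by \<open>d\<close>, so \<open>d\<close>, \<open>s\<close>, \<open>w\<close> would be independent
  with common neighbours \<open>y\<close> and \<open>z\<close>.\<close>

lemma complete_if_adjacent_both:
  assumes y: "y \<in> K" "z \<in> K" "z \<noteq> y" and d: "d \<in> S" "adjacent G d y" "adjacent G d z"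
    "\<And>v. adjacent G d v \<Longrightarrow> v = y \<or> v = z"
    and s: "s \<in> S" "s \<noteq> d" "adjacent G s y" "adjacent G s z"
  shows "complete s"
  unfolding complete_def
proof (intro conjI ballI)
  fix w assume w: "w \<in> K"
  show "adjacent G s w"
  proof (rule ccontr)
    assume n: "\<not> adjacent G s w"
    then have wn: "w \<noteq> y" "w \<noteq> z" using s by auto
    then have "\<not> adjacent G d w" using d by blast
    moreover have "w \<noteq> s" "w \<noteq> d" using w s(1) d(1) disj by auto
    moreover have "adjacent G w y" "adjacent G w z" using KK w y wn by auto
    ultimately show False
      using no_common_pair[of y z d s w] y d(2,3) s n SS[OF d(1) s(1)] by auto
  qed
qed (fact s(1))

text \<open>At least two of the three differ from the degree-two neighbour \<open>d\<close> of
  \<open>y\<close>, so it suffices to find a complete one among any two such neighbours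
  \<open>a\<close>, \<open>b\<close>.\<close>

lemma three_nbrs_complete:
  assumes y: "y \<in> K" and s: "s1 \<in> S" "s2 \<in> S" "s3 \<in> S" "s1 \<noteq> s2" "s1 \<noteq> s3" "s2 \<noteq> s3"
    and adj: "adjacent G s1 y" "adjacent G s2 y" "adjacent G s3 y"
  shows "complete s1 \<or> complete s2 \<or> complete s3"
proof -
  obtain d z where d: "d \<in> S" "z \<in> K" "z \<noteq> y" "adjacent G d y" "adjacent G d z"
    "\<And>v. adjacent G d v \<Longrightarrow> v = y \<or> v = z" using degree_two_nbr[OF y] by metis
  have "complete a \<or> complete b"
    if ab: "a \<in> S" "b \<in> S" "a \<noteq> b" "a \<noteq> d" "b \<noteq> d" "adjacent G a y" "adjacent G b y" for a b
  proof (rule ccontr)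
    assume "\<not> (complete a \<or> complete b)"
    then have nz: "\<not> adjacent G a z" "\<not> adjacent G b z"
      using complete_if_adjacent_both[OF y d(2,3,1,4,5,6)] ab by blast+
    have zy: "adjacent G z y" using KK d y by auto
    have zab: "\<not> adjacent G z a" "\<not> adjacent G z b" using nz by (auto simp: adjacent_sym)
    have zS: "z \<noteq> a" "z \<noteq> b" using d(2) ab disj by auto
    \<comment> \<open>Another common neighbour \<open>u\<close> would make \<open>a\<close>,
      \<open>b\<close>, \<open>z\<close> independent with common neighbours \<open>y\<close> and
      \<open>u\<close>.\<close>
    have common: "\<not> (adjacent G a u \<and> adjacent G b u)" if "u \<noteq> y" for u
    proof
      assume u: "adjacent G a u \<and> adjacent G b u"
      then have uK: "u \<in> K" "u \<noteq> z" using SK ab nz by auto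
      then have "adjacent G z u" using KK d by auto
      then show False
        using no_common_pair[of y u a b z] y uK u that ab zy nz zab zS SS[OF ab(1,2)] by auto
    qed
    obtain u where u: "u \<in> K" "u \<noteq> y" "adjacent G a u" using two_nbrs[OF ab(1)] by metis
    obtain v where v: "v \<in> K" "v \<noteq> y" "adjacent G b v" using two_nbrs[OF ab(2)] by metis
    have "\<not> adjacent G b u" "\<not> adjacent G a v" "u \<noteq> z" "v \<noteq> z" using common u v nz by blast+
    moreover from this have "u \<noteq> v" "\<not> adjacent G d u" "\<not> adjacent G d v" using u v d(6) by blast+
    \<comment> \<open>Now \<open>d\<close>, \<open>a\<close>, \<open>b\<close> have the private
      neighbours \<open>z\<close>, \<open>u\<close>, \<open>v\<close>, which is a snare centred at
      \<open>y\<close>.\<close>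
    ultimately show False
      using no_private_triple[of y z u v d a b] y d(1-5) u v ab nz by auto
  qed
  then show ?thesis using s adj by metis
qed

text \<open>Since \<open>K\<close> has at least three vertices, the degree-two vertex
  \<open>d\<close> is a third vertex beside two complete ones, and all three see \<open>y\<close>
  and \<open>z\<close>.\<close>

lemma complete_unique:
  assumes "complete s" "complete t"
  shows "s = t"
proof (rule ccontr)
  assume ne: "s \<noteq> t"
  obtain y where y: "y \<in> K" using card_K by (metis card.empty ex_in_conv not_numeral_le_zero)
  obtain d z where d: "d \<in> S" "z \<in> K" "z \<noteq> y" "adjacent G d y" "adjacent G d z"
    "\<And>v. adjacent G d v \<Longrightarrow> v = y \<or> v = z" using degree_two_nbr[OF y] by metis
  have "\<not> complete d"
  proof
    assume "complete d"
    then have "K \<subseteq> {y, z}" using d(6) by (auto simp: complete_def)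
    then have "card K \<le> card {y, z}" by (intro card_mono) auto
    also have "\<dots> \<le> 2" by (simp add: card_insert_if)
    finally show False using card_K by simp
  qed
  then have "d \<noteq> s" "d \<noteq> t" using assms by auto
  then show False
    using no_common_pair[of y z d s t] y d ne assms SS by (auto simp: complete_def)
qed

text \<open>Started in \<open>K\<close>, the cycle has clique vertices at even positions and stable
  ones at odd positions, so it is the rim of an \<open>n\<close>-sun whose \<open>k\<close> and
  \<open>d\<close> are these two sequences, and \<open>w\<close> completes a nova. Here
  \<open>w\<close> may lie in \<open>S\<close> or in \<open>K\<close>; both cases occur.\<close>

lemma no_alternating_cycle:
  assumes c: "cycle_list G vs"
    and alt: "\<And>a b. cyc_next vs a b \<Longrightarrow> a \<in> K \<Longrightarrow> b \<notin> K"
    and chord: "\<And>s y. s \<in> S \<Longrightarrow> s \<in> set vs \<Longrightarrow> y \<in> set vs \<Longrightarrow> adjacent G s y \<Longrightarrow>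
      cyc_next vs s y \<or> cyc_next vs y s"
    and w: "w \<notin> set vs" "\<And>y. y \<in> K \<Longrightarrow> y \<in> set vs \<Longrightarrow> adjacent G w y"
      "\<And>s. s \<in> S \<Longrightarrow> s \<in> set vs \<Longrightarrow> \<not> adjacent G w s"
  shows False
proof -
  have len: "3 \<le> length vs" using c by (simp add: cycle_list_def)
  have sub: "x \<in> S \<or> x \<in> K" if x: "x \<in> set vs" for x
  proof -
    obtain x' where "cyc_next vs x x'" using cyc_next_ex[OF x] len by auto
    then show ?thesis using cyc_next_adjacent[OF c] adjacent_verts[OF simple] V by blast
  qed
  \<comment> \<open>Stability of \<open>S\<close> already forbids two consecutive stable
    vertices.\<close>
  have nxt: "b \<in> K \<longleftrightarrow> a \<notin> K" if "cyc_next vs a b" for a b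
    using alt that cyc_next_adjacent[OF c that] cyc_next_set[OF that] sub SS by blast
  have "hd vs \<in> set vs" using len by (cases vs) auto
  then obtain b where "cyc_next vs (hd vs) b" using cyc_next_ex len by fastforce
  then obtain y where y: "y \<in> K" "y \<in> set vs" using nxt cyc_next_set by metis
  obtain us where us: "cycle_list G (y # us)" "set vs = insert y (set us)"
    "\<And>a b. cyc_next (y # us) a b \<longleftrightarrow> cyc_next vs a b"
    using cycle_list_split[OF c y(2)] by metis
  define xs where "xs = y # us"
  define L where "L = length xs"
  have xs: "distinct xs" "3 \<le> L" "set xs = set vs" "xs ! 0 = y"
    using us by (auto simp: xs_def L_def cycle_list_def)
  have nx: "cyc_next vs (xs ! i) (xs ! j) \<longleftrightarrow> j = Suc i mod L" if "i < L" "j < L" for i j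
    using cyc_next_nth_iff[of xs i j] xs that us(3) by (simp add: xs_def L_def)
  have inj: "xs ! i = xs ! j \<longleftrightarrow> i = j" if "i < L" "j < L" for i j
    using xs(1) that by (simp add: L_def nth_eq_iff_index_eq)
  have mem: "xs ! i \<in> set vs" if "i < L" for i
    using that unfolding L_def xs(3)[symmetric] by (rule nth_mem)
  have par: "xs ! i \<in> K \<longleftrightarrow> even i" if "i < L" for i
    using that
  proof (induction i)
    case 0
    then show ?case using xs(4) y by simp
  next
    case (Suc i)
    then have "cyc_next vs (xs ! i) (xs ! Suc i)" using nx[of i "Suc i"] by simp
    then show ?case using nxt Suc by auto
  qed
  \<comment> \<open>The closing edge returns to \<open>K\<close>, so the last position is odd and
    the length is even; being at least three, it is at least four.\<close>
  have "cyc_next vs (xs ! (L - 1)) (xs ! 0)" using nx[of "L - 1" 0] xs(2) by simp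
  then have "odd (L - 1)" using par[of "L - 1"] par[of 0] nxt xs(2) by auto
  then have "even L" using xs(2) by (cases L) auto
  then obtain n where n: "L = 2 * n" by (elim evenE)
  have n2: "2 \<le> n" using n xs(2) by simp
  define k d where "k = (\<lambda>i. xs ! (2 * i))" and "d = (\<lambda>i. xs ! (2 * i + 1))"
  have kK: "k i \<in> K" "k i \<in> set vs" if "i < n" for i
    using par[of "2 * i"] mem[of "2 * i"] that n by (auto simp: k_def)
  have dS: "d i \<in> S" "d i \<in> set vs" if "i < n" for i
    using par[of "2 * i + 1"] mem[of "2 * i + 1"] sub[of "xs ! (2 * i + 1)"] that n by (auto simp: d_def)
  have kn: "cyc_next vs (k j) (d i) \<longleftrightarrow> j = i" if "i < n" "j < n" for i j
    using nx[of "2 * j" "2 * i + 1"] that n by (auto simp: k_def d_def)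
  have dn: "cyc_next vs (d i) (k j) \<longleftrightarrow> j = Suc i mod n" if "i < n" "j < n" for i j
  proof -
    have "Suc (2 * i + 1) mod L = 2 * (Suc i mod n)" using n by (simp add: mult_mod_right)
    then show ?thesis using nx[of "2 * i + 1" "2 * j"] that n by (auto simp: k_def d_def)
  qed
  have "inj_on k {..<n}" "inj_on d {..<n}"
    using n by (auto simp: inj_on_def k_def d_def inj)
  moreover have "k i \<noteq> d j" if "i < n" "j < n" for i j using kK(1)[OF that(1)] dS(1)[OF that(2)] disj by auto
  moreover have "k i \<noteq> w" "d i \<noteq> w" if "i < n" for i using kK dS w(1) that by auto
  moreover have "adjacent G (k i) (k j) \<longleftrightarrow> i \<noteq> j" if "i < n" "j < n" for i j
    using KK[OF kK(1)[OF that(1)] kK(1)[OF that(2)]] inj[of "2 * i" "2 * j"] that n irrefl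
    by (auto simp: k_def)
  moreover have "adjacent G (d i) (k j) \<longleftrightarrow> j = i \<or> j = Suc i mod n" if "i < n" "j < n" for i j
    using chord[OF dS[OF that(1)] kK(2)[OF that(2)]] kn[OF that] dn[OF that]
      cyc_next_adjacent[OF c, of "d i" "k j"] cyc_next_adjacent[OF c, of "k j" "d i"]
      adjacent_sym[of G "k j" "d i"] by blast
  ultimately have "nova_copy G n k d w"
    unfolding nova_copy_iff using n2 SS dS kK w irrefl by auto
  then show False using no_nova by blast
qed

text \<open>A Hamiltonian cycle of \<open>G\<close> without the complete vertex has no edge inside \<open>K\<close>, so it is a
  chordless alternating cycle.\<close>

lemma not_complete: "\<not> complete s"
proof
  assume s: "complete s"
  then have sS: "s \<in> S" by (simp add: complete_def)
  obtain vs where vs: "cycle_list G vs" "set vs = verts G - {s}" using ham_minus_S[OF sS] by metis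
  have len: "2 \<le> length vs" and dist: "distinct vs" using vs(1) by (auto simp: cycle_list_def)
  have alt: "b \<notin> K" if ab: "cyc_next vs a b" "a \<in> K" for a b
  proof
    assume "b \<in> K"
    then have "adjacent G s a" "adjacent G s b" using s ab(2) by (auto simp: complete_def)
    then obtain vs' where "cycle_list G vs'" "set vs' = insert s (set vs)"
      using cycle_list_insert[OF vs(1) ab(1)] vs(2) by blast
    moreover have "insert s (set vs) = verts G" using vs(2) sS V by auto
    ultimately show False using not_ham by metis
  qed
  show False
  proof (rule no_alternating_cycle[OF vs(1), where w = s])
    show "b \<notin> K" if "cyc_next vs a b" "a \<in> K" for a b using alt that .
  next
    fix t y assume t: "t \<in> S" "t \<in> set vs" "y \<in> set vs" "adjacent G t y"
    then have y: "y \<in> K" using SK by blast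
    obtain p q where pq: "cyc_next vs p y" "cyc_next vs y q"
      using cyc_next_ex[OF t(3) len] cyc_prev_ex[OF t(3) len] by blast
    then have "p \<noteq> q" using cyc_next_neq_prev[OF vs(1)] by blast
    have q: "q \<in> S" "q \<noteq> s" "adjacent G q y"
      using alt[OF pq(2) y] cyc_next_set[OF pq(2)] vs(2) V cyc_next_adjacent[OF vs(1) pq(2)]
      by (auto simp: adjacent_sym)
    have "p \<notin> K" using alt[OF pq(1)] y by blast
    then have p: "p \<in> S" "p \<noteq> s" "adjacent G p y"
      using cyc_next_set[OF pq(1)] vs(2) V cyc_next_adjacent[OF vs(1) pq(1)] by auto
    \<comment> \<open>A chord from \<open>t\<close> would give \<open>y\<close> three neighbours in
      \<open>S\<close> on the cycle, one of which would be complete and different from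
      \<open>s\<close>.\<close>
    have "t \<noteq> s" using t vs(2) by auto
    then have "\<not> (complete t \<or> complete p \<or> complete q)" using complete_unique[OF s] p q by blast
    then have "t = p \<or> t = q"
      using three_nbrs_complete[OF y t(1) p(1) q(1)] \<open>p \<noteq> q\<close> t(4) p(3) q(3) by blast
    then show "cyc_next vs t y \<or> cyc_next vs y t" using pq by blast
  qed (use s vs(2) sS SS in \<open>auto simp: complete_def\<close>)
qed

section \<open>Turns of the cycle at the neighbours of the omitted vertex\<close>

text \<open>Otherwise \<open>s\<close>, \<open>a\<close>, \<open>b\<close> are three neighbours of
  \<open>y\<close> in \<open>S\<close>, and one of them would be complete.\<close>

lemma cycle_nbr_in_K:
  assumes s: "s \<in> S" and vs: "cycle_list G vs" "set vs = verts G - {s}" and y: "adjacent G s y"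
    and nx: "cyc_next vs y a" "cyc_next vs b y"
  shows "a \<in> K \<or> b \<in> K"
proof (rule ccontr)
  assume n: "\<not> (a \<in> K \<or> b \<in> K)"
  have yK: "y \<in> K" using SK s y by blast
  have ab: "a \<in> S" "b \<in> S" "a \<noteq> s" "b \<noteq> s"
    using n cyc_next_set[OF nx(1)] cyc_next_set[OF nx(2)] vs(2) V by auto
  have "adjacent G a y" "adjacent G b y"
    using cyc_next_adjacent[OF vs(1) nx(1)] cyc_next_adjacent[OF vs(1) nx(2)] by (auto simp: adjacent_sym)
  then show False
    using three_nbrs_complete[OF yK s ab(1,2)] ab(3,4) cyc_next_neq_prev[OF vs(1) nx] y not_complete by blast
qed

lemma next_not_both_K:
  assumes s: "s \<in> S" and vs: "cycle_list G vs" "set vs = verts G - {s}"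
    and y: "adjacent G s y" "adjacent G s y'" "y \<noteq> y'" and nx: "cyc_next vs y a" "cyc_next vs y' a'"
  shows "\<not> (a \<in> K \<and> a' \<in> K)"
proof
  assume "a \<in> K \<and> a' \<in> K"
  then obtain vs' where "cycle_list G vs'" "set vs' = insert s (set vs)"
    using cycle_list_rotation[OF vs(1) nx y(3) cl] vs(2) y by blast
  moreover have "insert s (set vs) = verts G" using vs(2) s V by auto
  ultimately show False using not_ham by metis
qed

lemma prev_not_both_K:
  assumes s: "s \<in> S" and vs: "cycle_list G vs" "set vs = verts G - {s}"
    and y: "adjacent G s y" "adjacent G s y'" "y \<noteq> y'" and nx: "cyc_next vs a y" "cyc_next vs a' y'"
  shows "\<not> (a \<in> K \<and> a' \<in> K)"
  by (rule next_not_both_K[OF s cycle_list_rev[OF vs(1)] _ y]) (use vs nx in \<open>simp_all add: cyc_next_rev_iff\<close>)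

text \<open>Pigeonhole: each of three neighbours of \<open>s\<close> has a cycle neighbour in
  \<open>K\<close> before or after it, so two of them share a side, which the rotations
  exclude.\<close>

lemma degree_two:
  assumes s: "s \<in> S" and y: "adjacent G s x" "adjacent G s y" "x \<noteq> y" "adjacent G s z"
  shows "z = x \<or> z = y"
proof (rule ccontr)
  assume z: "\<not> (z = x \<or> z = y)"
  obtain vs where vs: "cycle_list G vs" "set vs = verts G - {s}" using ham_minus_S[OF s] by metis
  have len: "2 \<le> length vs" using vs(1) by (auto simp: cycle_list_def)
  have ex: "\<exists>a b. cyc_next vs u a \<and> cyc_next vs b u" if "adjacent G s u" for u
  proof -
    have "u \<in> set vs" using that vs(2) adjacent_verts[OF simple that] by auto
    then show ?thesis using cyc_next_ex[OF _ len] cyc_prev_ex[OF _ len] by blast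
  qed
  obtain a b where x: "cyc_next vs x a" "cyc_next vs b x" using ex[OF y(1)] by blast
  obtain a' b' where y': "cyc_next vs y a'" "cyc_next vs b' y" using ex[OF y(2)] by blast
  obtain a'' b'' where z': "cyc_next vs z a''" "cyc_next vs b'' z" using ex[OF y(4)] by blast
  note N = next_not_both_K[OF s vs] and P = prev_not_both_K[OF s vs] and E = cycle_nbr_in_K[OF s vs]
  have ne: "x \<noteq> z" "y \<noteq> z" using z by auto
  show False
    using E[OF y(1) x] E[OF y(2) y'] E[OF y(4) z']
      N[OF y(1,2,3) x(1) y'(1)] N[OF y(1,4) ne(1) x(1) z'(1)] N[OF y(2,4) ne(2) y'(1) z'(1)]
      P[OF y(1,2,3) x(2) y'(2)] P[OF y(1,4) ne(1) x(2) z'(2)] P[OF y(2,4) ne(2) y'(2) z'(2)]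
    by blast
qed

text \<open>The cycle is the arc \<open>seg\<close> from \<open>x\<close> to \<open>y\<close>
  followed by the arc \<open>B\<close> from \<open>a\<close> to \<open>b\<close>. Closing
  \<open>seg\<close> through \<open>s\<close> gives a shorter cycle. An edge of it inside
  \<open>K\<close> could be replaced by a detour through all of \<open>B\<close>; without such an
  edge it alternates, and \<open>a\<close>, lying off it, serves as the centre of a nova.\<close>

lemma no_opposite_turns:
  assumes s: "s \<in> S" and vs: "cycle_list G vs" "set vs = verts G - {s}"
    and y: "adjacent G s y" "adjacent G s x" "y \<noteq> x" and nx: "cyc_next vs y a" "cyc_next vs b x"
    and K: "a \<in> K" "b \<in> K"
  shows False
proof -
  have sV: "insert s (set vs) = verts G" using vs(2) s V by auto
  have xy: "x \<in> K" "y \<in> K" "x \<in> set vs" "y \<in> set vs"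
    using SK[OF s y(1)] SK[OF s y(2)] cyc_next_set[OF nx(1)] cyc_next_set[OF nx(2)] by simp_all
  have sK: "s \<notin> K" using s disj by blast
  obtain us where us: "cycle_list G (x # us)" "set vs = insert x (set us)"
    "\<And>a b. cyc_next (x # us) a b \<longleftrightarrow> cyc_next vs a b"
    using cycle_list_split[OF vs(1) xy(3)] by metis
  have du: "us \<noteq> []" "distinct (x # us)" using us(1) by (auto simp: cycle_list_def)
  have b: "b = last us" using cyc_next_Cons(2)[OF du(2,1)] us(3) nx(2) by blast
  have "y \<in> set us" using us(2) xy y(3) by auto
  then obtain A B where AB: "us = A @ y # B" by (meson split_list)
  have "cyc_next (x # us) y (hd (B @ x # A))"
    unfolding cyc_next_def AB by (intro exI[of _ "x # A"] exI[of _ B]) auto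
  then have a: "a = hd (B @ x # A)" using us(3) nx(1) cyc_next_unique[OF du(2)] by metis
  have "B \<noteq> []"
  proof
    assume "B = []"
    then have "cyc_next vs y x" using a nx(1) by simp
    then obtain vs' where "cycle_list G vs'" "set vs' = insert s (set vs)"
      using cycle_list_insert[OF vs(1)] vs(2) y by blast
    then show False using not_ham sV by metis
  qed
  then have a: "a = hd B" and b: "b = last B" using a b AB by auto
  define seg where "seg = x # A @ [y]"
  have cyc: "cycle_list G (seg @ B)" using us(1) AB by (simp add: seg_def)
  have ends: "hd seg = x" "last seg = y" "seg \<noteq> []" "2 \<le> length seg" by (simp_all add: seg_def)
  have seg: "successively (adjacent G) seg" "distinct seg"
    "successively (adjacent G) B" "distinct B" "set seg \<inter> set B = {}"
    using cyc by (simp_all add: cycle_list_def successively_append_iff)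
  have sn: "s \<notin> set seg" "s \<notin> set B" using vs(2) us(2) AB by (auto simp: seg_def)
  have setV: "insert s (set seg \<union> set B) = verts G" using sV us(2) AB by (auto simp: seg_def)
  have sx: "adjacent G y s" using y by (simp add: adjacent_sym)
  have c: "cycle_list G (s # seg)"
    using seg(1,2) ends sn(1) y(2) sx by (simp add: cycle_list_def successively_Cons)
  have len: "2 \<le> length (s # seg)" using c by (simp add: cycle_list_def)
  \<comment> \<open>Every vertex of \<open>S\<close> has degree two, so its two cycle neighbours
    exhaust its neighbourhood. This gives both the absence of chords and the nonadjacency to
    \<open>hd B\<close>.\<close>
  have only: "v = p \<or> v = q"
    if "t \<in> S" "adjacent G t v" "cyc_next (s # seg) t p" "cyc_next (s # seg) q t" for t v p q
  proof -
    have "adjacent G t p" "adjacent G t q" "p \<noteq> q"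
      using cyc_next_adjacent[OF c] cyc_next_neq_prev[OF c] that by (auto simp: adjacent_sym[of G t q])
    then show ?thesis using degree_two that by blast
  qed
  have hdB: "hd B \<in> set B" "last B \<in> set B" using \<open>B \<noteq> []\<close> by auto
  show False
  proof (rule no_alternating_cycle[OF c, where w = "hd B"])
    fix u v assume uv: "cyc_next (s # seg) u v" "u \<in> K"
    show "v \<notin> K"
    proof
      assume vK: "v \<in> K"
      \<comment> \<open>Neither \<open>u\<close> nor \<open>v\<close> is \<open>s\<close>, so the
        pair is consecutive inside \<open>seg\<close> and is not one of the two cycle edges at
        \<open>s\<close>.\<close>
      obtain P0 Q0 where PQ: "s # seg = P0 @ u # Q0" "v = hd (Q0 @ P0)"
        using uv(1) unfolding cyc_next_def by blast
      then obtain P where P: "P0 = s # P" "seg = P @ u # Q0" using uv(2) sK by (cases P0) auto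
      then obtain Q where Q: "Q0 = v # Q" using PQ(2) vK sK by (cases Q0) auto
      have seg': "seg = P @ u # v # Q" using P Q by simp
      have B: "adjacent G u (hd B)" "adjacent G (last B) v"
        using KK[OF uv(2) K(1)] KK[OF K(2) vK] a b hdB seg(5) seg' by auto
      \<comment> \<open>Here \<open>P1\<close> leads from \<open>x\<close> to \<open>u\<close> and
        \<open>Q1\<close> from \<open>v\<close> to \<open>y\<close>; the ends of \<open>B\<close>
        lie in \<open>K\<close>, so \<open>B\<close> fits between \<open>u\<close> and
        \<open>v\<close>.\<close>
      define P1 Q1 where "P1 = P @ [u]" and "Q1 = v # Q"
      have seg1: "seg = P1 @ Q1" "P1 \<noteq> []" "Q1 \<noteq> []" by (simp_all add: P1_def Q1_def seg')
      have "hd P1 = x" "last Q1 = y" using ends(1,2) seg1 by simp_all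
      moreover have "adjacent G (last P1) (hd B)" "adjacent G (last B) (hd Q1)"
        using B by (simp_all add: P1_def Q1_def)
      moreover have "successively (adjacent G) P1" "successively (adjacent G) Q1"
        using seg(1) seg1 by (simp_all add: successively_append_iff)
      moreover have "distinct (s # P1 @ B @ Q1)"
        using seg(2,4,5) sn seg1(1) by auto
      moreover have "2 \<le> length P1 + length Q1" using ends(4) seg1(1) by simp
      ultimately have "cycle_list G (s # P1 @ B @ Q1)"
        using seg(3) seg1(2,3) y(2) sx \<open>B \<noteq> []\<close>
        by (simp add: cycle_list_def successively_append_iff successively_Cons)
      moreover have "set (s # P1 @ B @ Q1) = verts G" using setV seg1(1) by auto
      ultimately show False using not_ham by blast
    qed
  next
    fix t v assume t: "t \<in> S" "t \<in> set (s # seg)" "adjacent G t v"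
    then show "cyc_next (s # seg) t v \<or> cyc_next (s # seg) v t"
      using cyc_next_ex[OF t(2) len] cyc_prev_ex[OF t(2) len] only by blast
  next
    show "hd B \<notin> set (s # seg)" using hdB sn seg(5) by auto
    show "adjacent G (hd B) v" if "v \<in> K" "v \<in> set (s # seg)" for v
      using KK K a that hdB sK seg(5) by (metis IntI empty_iff set_ConsD)
    fix t assume t: "t \<in> S" "t \<in> set (s # seg)"
    show "\<not> adjacent G (hd B) t"
    proof
      assume "adjacent G (hd B) t"
      then have "adjacent G t (hd B)" by (simp add: adjacent_sym)
      then have "hd B \<in> set (s # seg)"
        using cyc_next_ex[OF t(2) len] cyc_prev_ex[OF t(2) len] only[OF t(1)] cyc_next_set by metis
      then show False using hdB sn seg(5) by auto
    qed
  qed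
qed

text \<open>Both neighbours \<open>x\<close>, \<open>y\<close> of \<open>s\<close> turn into
  \<open>K\<close> on some side; equal sides are excluded by rotation, opposite sides in either
  order by the preceding lemma.\<close>

lemma contradiction: False
proof -
  obtain y where "y \<in> K" using card_K by (metis card.empty ex_in_conv not_numeral_le_zero)
  then obtain s where s: "s \<in> S" using K_nbr by blast
  obtain x y where xy: "x \<noteq> y" "adjacent G s x" "adjacent G s y" using two_nbrs[OF s] by metis
  obtain vs where vs: "cycle_list G vs" "set vs = verts G - {s}" using ham_minus_S[OF s] by metis
  have len: "2 \<le> length vs" using vs(1) by (auto simp: cycle_list_def)
  have ex: "\<exists>a b. cyc_next vs u a \<and> cyc_next vs b u" if "adjacent G s u" for u
  proof -
    have "u \<in> set vs" using that vs(2) adjacent_verts[OF simple that] by auto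
    then show ?thesis using cyc_next_ex[OF _ len] cyc_prev_ex[OF _ len] by blast
  qed
  obtain a b where x: "cyc_next vs x a" "cyc_next vs b x" using ex[OF xy(2)] by blast
  obtain a' b' where y: "cyc_next vs y a'" "cyc_next vs b' y" using ex[OF xy(3)] by blast
  show False
    using cycle_nbr_in_K[OF s vs xy(2) x] cycle_nbr_in_K[OF s vs xy(3) y]
      next_not_both_K[OF s vs xy(2,3,1) x(1) y(1)] prev_not_both_K[OF s vs xy(2,3,1) x(2) y(2)]
      no_opposite_turns[OF s vs xy(2,3,1) x(1) y(2)]
      no_opposite_turns[OF s vs xy(3,2) xy(1)[symmetric] y(1) x(2)] by blast
qed

end

text \<open>A vertex of \<open>K\<close> without neighbours in \<open>S\<close> could be moved to
  \<open>S\<close>, keeping the partition valid; a stable side of maximum size rules this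
  out.\<close>

lemma split_graph_maximal_stable:
  assumes "simple_graph G" "split_graph G"
  obtains S K where "S \<union> K = verts G" "S \<inter> K = {}" "stable_set G S" "clique G K"
    "\<And>y. y \<in> K \<Longrightarrow> \<exists>s\<in>S. adjacent G s y"
proof -
  define P where "P S \<longleftrightarrow> (\<exists>K. S \<union> K = verts G \<and> S \<inter> K = {} \<and> stable_set G S \<and> clique G K)" for S
  have fin: "finite (verts G)" using assms(1) by (simp add: simple_graph_def)
  then have bound: "\<forall>S. P S \<longrightarrow> card S < Suc (card (verts G))"
    by (auto simp: P_def less_Suc_eq_le intro!: card_mono)
  obtain S0 where "P S0" using assms(2) unfolding split_graph_def P_def by blast
  then obtain S where S: "P S" and max: "\<And>S'. P S' \<Longrightarrow> card S' \<le> card S"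
    using ex_has_greatest_nat[of P S0 card, OF _ bound] by blast
  obtain K where K: "S \<union> K = verts G" "S \<inter> K = {}" "stable_set G S" "clique G K" using S unfolding P_def by blast
  have "\<exists>s\<in>S. adjacent G s y" if y: "y \<in> K" for y
  proof (rule ccontr)
    assume n: "\<not> (\<exists>s\<in>S. adjacent G s y)"
    then have "\<forall>s\<in>S. \<not> adjacent G y s" by (simp add: adjacent_sym)
    moreover have "\<not> adjacent G y y" using adjacent_verts(3)[OF assms(1)] by blast
    ultimately have "stable_set G (insert y S)" using K n y by (auto simp: stable_set_def)
    moreover have "clique G (K - {y})" using K(4) by (auto simp: clique_def)
    moreover have "insert y S \<union> (K - {y}) = verts G" "insert y S \<inter> (K - {y}) = {}" using K y by auto
    ultimately have "P (insert y S)" unfolding P_def by blast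
    then have "card (insert y S) \<le> card S" by (rule max)
    moreover have "y \<notin> S" "finite S" using K y fin by (auto intro: finite_subset)
    ultimately show False by simp
  qed
  then show thesis using that K by blast
qed

theorem theorem2:
  "HC_obstruction snare \<and>
   (\<forall>n\<ge>2. HC_obstruction (nova n)) \<and>
   (\<forall>G :: 'a graph. simple_graph G \<longrightarrow> split_graph G \<longrightarrow>
      (HC_obstruction G \<longleftrightarrow> graph_iso G snare \<or> (\<exists>n\<ge>2. graph_iso G (nova n))))"
proof (intro conjI allI impI)
  show "HC_obstruction snare"
    by (rule snare_copy_HC_obstruction[OF simple_graph_snare snare_copy_snare])
  show "HC_obstruction (nova n)" if "2 \<le> n" for n
    using nova_copy_HC_obstruction[OF simple_graph_nova nova_copy_nova] that by simp
  fix G :: "'a graph" assume G: "simple_graph G" "split_graph G"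
  show "HC_obstruction G \<longleftrightarrow> graph_iso G snare \<or> (\<exists>n\<ge>2. graph_iso G (nova n))"
  proof
    assume obs: "HC_obstruction G"
    show "graph_iso G snare \<or> (\<exists>n\<ge>2. graph_iso G (nova n))"
    proof (rule ccontr)
      assume n: "\<not> ?thesis"
      obtain S K where SK: "S \<union> K = verts G" "S \<inter> K = {}" "stable_set G S" "clique G K"
        "\<And>y. y \<in> K \<Longrightarrow> \<exists>s\<in>S. adjacent G s y"
        using split_graph_maximal_stable[OF G] by blast
      \<comment> \<open>A copy would span \<open>G\<close>, and spanning copies with equal
        parameters are isomorphic, against the assumption on \<open>G\<close>.\<close>
      have "\<not> nova_copy G m k d w" for m k d w
      proof
        assume c: "nova_copy G m k d w"
        then have m: "2 \<le> m" by (simp add: nova_copy_def)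
        have "graph_iso G (nova m)"
          by (rule split_copy_iso[OF c[unfolded nova_copy_def, THEN conjunct2] obstruction_nova_copy[OF obs c]
              nova_copy_nova(1)[OF m, unfolded nova_copy_def, THEN conjunct2] nova_copy_nova(2)[OF m]])
        then show False using n m by blast
      qed
      moreover have "\<not> snare_copy G k d w" for k d w
      proof
        assume c: "snare_copy G k d w"
        have "graph_iso G snare"
          by (rule split_copy_iso[OF c[unfolded snare_copy_def] obstruction_snare_copy[OF obs c]
              snare_copy_snare(1)[unfolded snare_copy_def] snare_copy_snare(2)])
        then show False using n by blast
      qed
      ultimately interpret copy_free_split_obstruction G S K
        using obs SK by unfold_locales
      show False by (rule contradiction)
    qed
  next
    assume "graph_iso G snare \<or> (\<exists>n\<ge>2. graph_iso G (nova n))"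
    then show "HC_obstruction G"
    proof (elim disjE exE conjE)
      assume "graph_iso G snare"
      then obtain k d w where "snare_copy G k d w" "verts G = copy_verts 3 k d w"
        using split_copy_transfer[OF _ snare_copy_snare(1)[unfolded snare_copy_def] snare_copy_snare(2)]
        unfolding snare_copy_def by blast
      then show ?thesis by (rule snare_copy_HC_obstruction[OF G(1)])
    next
      fix n assume n: "2 \<le> n" "graph_iso G (nova n)"
      then obtain k d w where "nova_copy G n k d w" "verts G = copy_verts n k d w"
        using split_copy_transfer[OF n(2) nova_copy_nova(1)[OF n(1), unfolded nova_copy_def, THEN conjunct2]
            nova_copy_nova(2)[OF n(1)]]
        unfolding nova_copy_def by blast
      then show ?thesis by (rule nova_copy_HC_obstruction[OF G(1)])
    qed
  qed
qed

end
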